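(* Let $\epsilon\in(0,1)$ and $q>0$, and let $X$ be a real-valued random variable such that $\log \mathbb{P}(X\geqslant x)\sim -q x^{1-\epsilon}$ as $x\to\infty$, such that $\mathbb{E}[|X|^{2+\gamma}]<\infty$ for some $\gamma>0$, and such that $\mathbb{E}[X]=0$. Let $\sigma^2=\mathrm{Var}(X)$ with $\sigma>0$. For all $n\geqslant 1$, let $X_1,\dots,X_n$ be i.i.d. copies of $X$ and let $S_n=X_1+\dots+X_n$. Then, for all $C>0$ and $x_n=Cn^{1/(1+\epsilon)}$, $$\lim_{n\to\infty}\frac{n}{x_n^2}\log\mathbb{P}(S_n\geqslant x_n) = -\inf_{0\leqslant t\leqslant 1}\left\{\frac{q(1-t)^{1-\epsilon}}{C^{1+\epsilon}}+\frac{t^2}{2\sigma^2}\right\}.$$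
   Context: The notation $f(x)\sim g(x)$ means $f(x)/g(x)\to 1$. Here $\sigma$ is the standard deviation of $X$ (the tail assumption implies that $X$ is not almost surely constant, so $\sigma>0$ is automatic). *)

theory Defs
  imports "HOL-Probability.Probability" "HOL-Library.Landau_Symbols"
begin

end

theory Submission
  imports Defs "HOL-Real_Asymp.Real_Asymp"
begin

text \<open>
  Write \<open>v = x\<^sup>2 / n\<close>; since \<open>x powr (1 - \<epsilon>) = v / C powr (1 + \<epsilon>)\<close>, one big jump and a moderate
  deviation of all summands both have cost of order \<open>v\<close>.

  Lower bound: let one summand exceed \<open>(1 - t) x\<close> and the sum of the others \<open>t x\<close>. The second
  probability is at least \<open>exp (- v (t\<^sup>2 / (2 \<sigma>\<^sup>2) + o(1)))\<close> by the central limit theorem applied to blocks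
  of length of order \<open>n / v\<close>.

  Upper bound: apply Markov's inequality to \<open>\<Prod>i. exp (g (X\<^sub>i))\<close> where \<open>g y = \<theta> y\<close> below a level \<open>b = \<delta> x\<close>
  and \<open>g y = q' y powr (1 - \<epsilon>)\<close> above it, with \<open>q' < q\<close>. For small \<open>\<delta>\<close> the truncated linear part has
  the Gaussian exponential moment up to negligible terms, and the concave part handles all large
  summands at once by subadditivity. Finitely many slopes \<open>\<theta>\<close> of order \<open>x / n\<close> cover the event \<open>S\<^sub>n \<ge> x\<close>.
\<close>

section \<open>Convolution powers of a distribution and their upper tails\<close>

text \<open>The law of a sum of \<open>n\<close> i.i.d. variables, expressed through the common law
  alone. The lower bound can thus be proved without the spaces \<open>M n\<close>, which may change
  with \<open>n\<close>.\<close>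

primrec conv_power :: "nat \<Rightarrow> real measure \<Rightarrow> real measure" where
  "conv_power 0 \<mu> = return borel 0"
| "conv_power (Suc n) \<mu> = (\<mu> \<star> conv_power n \<mu>)"

lemma real_distribution_convolution:
  assumes "real_distribution \<mu>" "real_distribution \<nu>"
  shows "real_distribution (\<mu> \<star> \<nu>)"
proof -
  interpret M: real_distribution \<mu> by fact
  interpret N: real_distribution \<nu> by fact
  interpret P: pair_prob_space \<mu> \<nu> ..
  show ?thesis
    unfolding convolution_def by (rule P.real_distribution_distr) measurable
qed

lemma real_distribution_conv_power:
  assumes "real_distribution \<mu>"
  shows "real_distribution (conv_power n \<mu>)"
proof (induction n)
  case 0
  show ?case
    by (simp add: real_distribution_def real_distribution_axioms_def prob_space_return)
next
  case (Suc n)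
  then show ?case using assms by (simp add: real_distribution_convolution)
qed

lemma finite_measure_real_distribution: "real_distribution \<mu> \<Longrightarrow> finite_measure \<mu>"
  by (simp add: real_distribution_def prob_space_def)

lemma sets_real_distribution: "real_distribution \<mu> \<Longrightarrow> sets \<mu> = sets borel"
  by (simp add: real_distribution.events_eq_borel)

lemma space_real_distribution: "real_distribution \<mu> \<Longrightarrow> space \<mu> = UNIV"
  using sets_eq_imp_space_eq[OF sets_real_distribution] by simp

lemma conv_return_zero:
  assumes "real_distribution \<mu>"
  shows "(return borel 0 \<star> \<mu>) = \<mu>"
proof (rule measure_eqI)
  show "sets (return borel 0 \<star> \<mu>) = sets \<mu>"
    using sets_real_distribution[OF assms] by simp
  fix A assume "A \<in> sets (return borel 0 \<star> \<mu>)"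
  then have A: "A \<in> sets borel" by simp
  have "real_distribution (conv_power 0 \<mu>)" by (rule real_distribution_conv_power[OF assms])
  then have r: "real_distribution (return borel 0)" by simp
  have "emeasure (return borel 0 \<star> \<mu>) A = \<integral>\<^sup>+x. emeasure \<mu> {a. a + x \<in> A} \<partial>return borel 0"
    by (rule convolution_emeasure[OF A])
      (use r assms in \<open>simp_all add: finite_measure_real_distribution sets_real_distribution space_real_distribution\<close>)
  also have "\<dots> = emeasure \<mu> {a. a + 0 \<in> A}"
  proof (rule nn_integral_return)
    interpret finite_measure \<mu> by (rule finite_measure_real_distribution[OF assms])
    have [measurable_cong]: "sets \<mu> = sets borel" by (rule sets_real_distribution[OF assms])
    note [measurable] = A
    have *: "{a. a + x \<in> A} = {a \<in> space \<mu>. a + x \<in> A}" for x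
      using space_real_distribution[OF assms] by simp
    show "(\<lambda>x. emeasure \<mu> {a. a + x \<in> A}) \<in> borel_measurable borel"
      unfolding * by measurable
  qed simp
  finally show "emeasure (return borel 0 \<star> \<mu>) A = emeasure \<mu> A" by simp
qed

lemma conv_power_add:
  assumes "real_distribution \<mu>"
  shows "conv_power (m + n) \<mu> = (conv_power m \<mu> \<star> conv_power n \<mu>)"
proof (induction m)
  case 0
  show ?case by (simp add: conv_return_zero real_distribution_conv_power assms)
next
  case (Suc m)
  then show ?case
    by (simp add: convolution_associative assms finite_measure_real_distribution sets_real_distribution
        real_distribution_conv_power)
qed

text \<open>The rectangle \<open>{y..} \<times> {z..}\<close> lies in the preimage of
  \<open>{y + z..}\<close> under addition, and its product measure factorises. The lower bound on
  the tail uses independence only in this form.\<close>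

lemma convolution_atLeast_ge:
  assumes "real_distribution \<mu>" "real_distribution \<nu>"
  shows "measure \<mu> {y..} * measure \<nu> {z..} \<le> measure (\<mu> \<star> \<nu>) {y + z..}"
proof -
  interpret M: real_distribution \<mu> by fact
  interpret N: real_distribution \<nu> by fact
  interpret P: pair_prob_space \<mu> \<nu> ..
  have "measure \<mu> {y..} * measure \<nu> {z..} = measure (\<mu> \<Otimes>\<^sub>M \<nu>) ({y..} \<times> {z..})"
    by (simp add: measure_def N.emeasure_pair_measure_Times enn2real_mult)
  also have "\<dots> \<le> measure (\<mu> \<Otimes>\<^sub>M \<nu>) ((\<lambda>(x, y). x + y) -` {y + z..} \<inter> space (\<mu> \<Otimes>\<^sub>M \<nu>))"
  proof (rule P.P.finite_measure_mono)
    show "(\<lambda>(x, y). x + y) -` {y + z..} \<inter> space (\<mu> \<Otimes>\<^sub>M \<nu>) \<in> sets (\<mu> \<Otimes>\<^sub>M \<nu>)"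
      by measurable
  qed (auto simp: space_pair_measure)
  also have "\<dots> = measure (\<mu> \<star> \<nu>) {y + z..}"
    unfolding convolution_def by (subst measure_distr) auto
  finally show ?thesis .
qed

lemma conv_power_add_ge:
  assumes "real_distribution \<mu>"
  shows "measure (conv_power m \<mu>) {y..} * measure (conv_power n \<mu>) {z..}
    \<le> measure (conv_power (m + n) \<mu>) {y + z..}"
  unfolding conv_power_add[OF assms]
  by (intro convolution_atLeast_ge real_distribution_conv_power assms)

lemma conv_power_mult_ge:
  assumes "real_distribution \<mu>"
  shows "measure (conv_power k \<mu>) {y..} ^ m \<le> measure (conv_power (m * k) \<mu>) {real m * y..}"
proof (induction m)
  case 0
  show ?case by (simp add: measure_return)
next
  case (Suc m)
  have "measure (conv_power k \<mu>) {y..} ^ Suc m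
      \<le> measure (conv_power k \<mu>) {y..} * measure (conv_power (m * k) \<mu>) {real m * y..}"
    using Suc by (simp add: mult_left_mono)
  also have "\<dots> \<le> measure (conv_power (k + m * k) \<mu>) {y + real m * y..}"
    by (rule conv_power_add_ge[OF assms])
  finally show ?case by (simp add: algebra_simps)
qed

text \<open>The bridge from random variables to \<open>conv_power\<close>. It serves both the given
  \<open>Y n\<close> and the coordinates of the infinite product on which the central limit theorem
  is applied.\<close>

lemma (in prob_space) distr_sum_iid:
  assumes "finite I" "indep_vars (\<lambda>_. borel) Y I" "\<And>i. i \<in> I \<Longrightarrow> distr M borel (Y i) = \<mu>"
  shows "distr M borel (\<lambda>\<omega>. \<Sum>i\<in>I. Y i \<omega>) = conv_power (card I) \<mu>"
  using assms
proof (induction I rule: finite_induct)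
  case empty
  show ?case by (auto intro!: measure_eqI simp: emeasure_distr prob_space.emeasure_space_1 emeasure_space_1 split: split_indicator)
next
  case (insert j I)
  have rv[measurable]: "random_variable borel (Y i)" if "i \<in> insert j I" for i
    using insert.prems(1) that by (auto simp: indep_vars_def)
  have "indep_vars (\<lambda>_. borel) Y I"
    using insert.prems(1) by (rule indep_vars_subset) auto
  with insert have IH: "distr M borel (\<lambda>\<omega>. \<Sum>i\<in>I. Y i \<omega>) = conv_power (card I) \<mu>"
    by simp
  have "distr M borel (\<lambda>\<omega>. Y j \<omega> + (\<Sum>i\<in>I. Y i \<omega>))
      = (distr M borel (Y j) \<star> distr M borel (\<lambda>\<omega>. \<Sum>i\<in>I. Y i \<omega>))"
    by (intro sum_indep_random_variable indep_vars_sum insert) (auto intro!: borel_measurable_sum)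
  then show ?case using insert IH by simp
qed

section \<open>Central limit theorem and the lower bound for moderate deviations\<close>

text \<open>The coordinates of the infinite product of \<mu> are an i.i.d. sequence with law \<mu>,
  to which the central limit theorem applies. Weak convergence passes to the half-line because its
  frontier is one point, which the normal law does not charge.\<close>

lemma conv_power_CLT:
  assumes "real_distribution \<mu>" "0 < \<sigma>" "integrable \<mu> (\<lambda>x. x\<^sup>2)"
    and "(\<integral>x. x \<partial>\<mu>) = 0" "(\<integral>x. x\<^sup>2 \<partial>\<mu>) = \<sigma>\<^sup>2"
  shows "(\<lambda>n. measure (conv_power n \<mu>) {s * sqrt (real n)..})
    \<longlonglongrightarrow> measure std_normal_distribution {s / \<sigma>..}"
proof -
  interpret \<mu>: real_distribution \<mu> by fact
  let ?P = "PiM UNIV (\<lambda>_::nat. \<mu>)"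
  interpret P: product_prob_space "\<lambda>_::nat. \<mu>" UNIV ..
  interpret P: prob_space ?P by (rule prob_space_PiM) (rule \<mu>.prob_space_axioms)
  interpret Z: real_distribution std_normal_distribution by (rule real_dist_normal_dist)
  have rv: "(\<lambda>\<omega>. \<omega> i) \<in> borel_measurable ?P" for i :: nat
    using measurable_component_singleton[of i UNIV "\<lambda>_. \<mu>"]
    by (simp add: measurable_cong_sets[OF refl \<mu>.events_eq_borel])
  have d: "distr ?P borel (\<lambda>\<omega>. \<omega> i) = \<mu>" for i :: nat
    using P.PiM_component[of i] distr_cong[OF refl \<mu>.events_eq_borel, of ?P "\<lambda>\<omega>. \<omega> i" "\<lambda>\<omega>. \<omega> i"]
    by simp
  have ind: "P.indep_vars (\<lambda>_. borel) (\<lambda>i \<omega>. \<omega> i) (UNIV :: nat set)"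
  proof (subst P.indep_vars_iff_distr_eq_PiM[OF _ rv])
    have "distr ?P (\<Pi>\<^sub>M i\<in>UNIV. borel) (\<lambda>\<omega>. \<lambda>i\<in>UNIV. \<omega> i) = distr ?P ?P (\<lambda>\<omega>. \<omega>)"
      by (intro distr_cong sets_PiM_cong) auto
    then show "distr ?P (\<Pi>\<^sub>M i\<in>UNIV. borel) (\<lambda>\<omega>. \<lambda>i\<in>UNIV. \<omega> i)
        = (\<Pi>\<^sub>M i\<in>UNIV. distr ?P borel (\<lambda>\<omega>. \<omega> i))"
      by (simp add: d distr_id)
  qed simp
  have e: "(\<integral>\<omega>. f (\<omega> i) \<partial>?P) = (\<integral>x. f x \<partial>\<mu>)" if "f \<in> borel_measurable borel" for f :: "real \<Rightarrow> real" and i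
    using integral_distr[OF rv that, of i] d[of i] by simp
  have mean: "(\<integral>\<omega>. \<omega> i \<partial>?P) = 0" for i
    using e[of "\<lambda>x. x" i] assms by simp
  have "integrable ?P (\<lambda>\<omega>. (\<omega> i)\<^sup>2)" for i
    using integrable_distr_eq[OF rv, of "\<lambda>x. x\<^sup>2" i] assms(3) d[of i] by simp
  moreover have "P.variance (\<lambda>\<omega>. \<omega> i) = \<sigma>\<^sup>2" for i
    using e[of "\<lambda>x. x\<^sup>2" i] assms(5) by (simp add: mean)
  ultimately have w: "weak_conv_m (\<lambda>n. distr ?P borel (\<lambda>\<omega>. (\<Sum>i<n. \<omega> i) / sqrt (n * \<sigma>\<^sup>2))) std_normal_distribution"
    by (intro P.central_limit_theorem_zero_mean[where \<mu> = \<mu>] ind mean assms(2) d)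
  have rs: "(\<lambda>\<omega>. (\<Sum>i<n. \<omega> i)) \<in> borel_measurable ?P" for n :: nat
    using rv by (intro borel_measurable_sum) auto
  have lim: "(\<lambda>n. measure (distr ?P borel (\<lambda>\<omega>. (\<Sum>i<n. \<omega> i) / sqrt (n * \<sigma>\<^sup>2))) {s / \<sigma>..})
      \<longlonglongrightarrow> measure std_normal_distribution {s / \<sigma>..}"
  proof (rule weak_conv_imp_continuity_set_conv[OF _ _ w])
    show "real_distribution (distr ?P borel (\<lambda>\<omega>. (\<Sum>i<n. \<omega> i) / sqrt (n * \<sigma>\<^sup>2)))" for n
      using rs by (intro P.real_distribution_distr) simp
    have "frontier {s / \<sigma>..} = {s / \<sigma>}"
      by (auto simp: frontier_def)
    moreover have "emeasure std_normal_distribution {s / \<sigma>} = 0"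
      by (subst emeasure_density) (auto simp: nn_integral_indicator_singleton)
    ultimately show "emeasure std_normal_distribution (frontier {s / \<sigma>..}) = 0"
      by simp
  qed (auto intro: real_dist_normal_dist)
  \<comment> \<open>At \<open>n = 0\<close> the normalised sum is \<open>0 / 0 = 0\<close>, and the
    two sides can differ; hence \<open>n \<ge> 1\<close>, which the limit tolerates.\<close>
  have eq: "measure (distr ?P borel (\<lambda>\<omega>. (\<Sum>i<n. \<omega> i) / sqrt (n * \<sigma>\<^sup>2))) {s / \<sigma>..}
      = measure (conv_power n \<mu>) {s * sqrt (real n)..}" if "n \<ge> 1" for n
  proof -
    have "P.indep_vars (\<lambda>_. borel) (\<lambda>i \<omega>. \<omega> i) {..<n}"
      using ind by (rule P.indep_vars_subset) auto
    then have c: "distr ?P borel (\<lambda>\<omega>. \<Sum>i<n. \<omega> i) = conv_power n \<mu>"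
      using P.distr_sum_iid[of "{..<n}" "\<lambda>i \<omega>. \<omega> i" \<mu>] d by simp
    have "measure (distr ?P borel (\<lambda>\<omega>. (\<Sum>i<n. \<omega> i) / sqrt (n * \<sigma>\<^sup>2))) {s / \<sigma>..}
      = measure ?P ((\<lambda>\<omega>. (\<Sum>i<n. \<omega> i) / sqrt (n * \<sigma>\<^sup>2)) -` {s / \<sigma>..} \<inter> space ?P)"
      using rs by (intro measure_distr) auto
    also have "\<dots> = measure ?P ((\<lambda>\<omega>. (\<Sum>i<n. \<omega> i)) -` {s * sqrt (real n)..} \<inter> space ?P)"
      using that assms(2) by (intro arg_cong[where f = "measure ?P"])
        (auto simp: real_sqrt_mult field_simps)
    also have "\<dots> = measure (conv_power n \<mu>) {s * sqrt (real n)..}"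
      unfolding c[symmetric] using rs by (intro measure_distr[symmetric]) auto
    finally show ?thesis .
  qed
  show ?thesis
    by (rule Lim_transform_eventually[OF lim]) (auto intro!: eventually_mono[OF eventually_ge_at_top[of 1]] eq)
qed

text \<open>On the unit interval \<open>{a..a + 1}\<close> the density is smallest at the right end,
  and \<open>exp (- 2)\<close> absorbs the factor \<open>1 / sqrt (2 * pi)\<close>. Such crude
  constants are harmless: the bound is applied with \<open>a\<close> proportional to a large
  \<open>L\<close> and divided by \<open>L\<^sup>2\<close>, which leaves only the leading
  coefficient 1/2.\<close>

lemma std_normal_tail_lower:
  assumes "0 \<le> a"
  shows "exp (- ((a + 1)\<^sup>2 / 2 + 2)) < measure std_normal_distribution {a..}"
proof -
  interpret Z: real_distribution std_normal_distribution by (rule real_dist_normal_dist)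
  have "sqrt (2 * pi) \<le> sqrt (3\<^sup>2)"
    using pi_less_4 by (intro real_sqrt_le_mono) (simp add: power2_eq_square)
  also have "\<dots> < exp 2"
    using exp_lower_Taylor_quadratic[of "2::real"] by simp
  finally have s: "sqrt (2 * pi) < exp 2" .
  have "exp (- ((a + 1)\<^sup>2 / 2 + 2)) = exp (- ((a + 1)\<^sup>2 / 2)) / exp 2"
    unfolding exp_diff[symmetric] by simp
  also have "\<dots> < exp (- ((a + 1)\<^sup>2 / 2)) / sqrt (2 * pi)"
    using s by (intro divide_strict_left_mono) auto
  also have "\<dots> = std_normal_density (a + 1)"
    by (simp add: std_normal_density_def)
  also have "\<dots> \<le> measure std_normal_distribution {a..a + 1}"
  proof -
    have "ennreal (std_normal_density (a + 1)) = (\<integral>\<^sup>+y. ennreal (std_normal_density (a + 1)) * indicator {a..a + 1} y \<partial>lborel)"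
      by (simp add: nn_integral_cmult_indicator)
    also have "\<dots> \<le> (\<integral>\<^sup>+y. ennreal (std_normal_density y) * indicator {a..a + 1} y \<partial>lborel)"
      using assms by (intro nn_integral_mono)
        (auto simp: std_normal_density_def split: split_indicator intro!: ennreal_leI divide_right_mono power_mono)
    also have "\<dots> = emeasure std_normal_distribution {a..a + 1}"
      by (simp add: emeasure_density)
    finally show ?thesis
      by (simp add: Z.emeasure_eq_measure)
  qed
  also have "\<dots> \<le> measure std_normal_distribution {a..}"
    by (intro Z.finite_measure_mono) auto
  finally show ?thesis .
qed

text \<open>By the central limit theorem at \<open>s = 0\<close> the bound holds for all large
  \<open>n\<close>; the finitely many others are positive and enter through a minimum. Uniformity in
  \<open>n\<close> is what matters: the lemma treats the incomplete last block, whose length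
  varies.\<close>

lemma conv_power_nonneg_tail_bound:
  assumes "real_distribution \<mu>" "0 < \<sigma>" "integrable \<mu> (\<lambda>x. x\<^sup>2)"
    and "(\<integral>x. x \<partial>\<mu>) = 0" "(\<integral>x. x\<^sup>2 \<partial>\<mu>) = \<sigma>\<^sup>2" "0 < measure \<mu> {0..}"
  obtains c where "0 < c" "\<And>n. c \<le> measure (conv_power n \<mu>) {0..}"
proof -
  have pos: "0 < measure (conv_power n \<mu>) {0..}" for n
  proof (induction n)
    case (Suc n)
    have "0 < measure \<mu> {0..} * measure (conv_power n \<mu>) {0..}" using Suc assms by simp
    also have "\<dots> \<le> measure (\<mu> \<star> conv_power n \<mu>) {0 + 0..}"
      by (intro convolution_atLeast_ge real_distribution_conv_power assms)
    finally show ?case by simp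
  qed (simp add: measure_return)
  define e where "e = exp (- ((0 + 1)\<^sup>2 / 2 + 2 :: real))"
  have "e < measure std_normal_distribution {0..}"
    unfolding e_def by (rule std_normal_tail_lower) simp
  then have "eventually (\<lambda>n. e < measure (conv_power n \<mu>) {0..}) sequentially"
    using conv_power_CLT[OF assms(1-5), of 0] by (intro order_tendstoD(1)) auto
  then obtain n0 where n0: "e < measure (conv_power n \<mu>) {0..}" if "n \<ge> n0" for n
    by (auto simp: eventually_sequentially)
  define c where "c = Min (insert e ((\<lambda>n. measure (conv_power n \<mu>) {0..}) ` {..<n0}))"
  show ?thesis
  proof
    show "0 < c" unfolding c_def using pos by (subst Min_gr_iff) (auto simp: e_def)
    show "c \<le> measure (conv_power n \<mu>) {0..}" for n
    proof (cases "n < n0")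
      case True then show ?thesis unfolding c_def by (intro Min_le) auto
    next
      case False
      have "c \<le> e" unfolding c_def by (intro Min_le) auto
      then show ?thesis using n0[of n] False by simp
    qed
  qed
qed

text \<open>Split \<open>n - 1\<close> summands into blocks of length about \<open>(L n / x)\<^sup>2\<close>; the central limit theorem
  bounds the contribution of each block from below, and \<open>L\<close> is large.\<close>
lemma moderate_deviation_lower:
  assumes "real_distribution \<mu>" "0 < \<sigma>" "integrable \<mu> (\<lambda>x. x\<^sup>2)"
    and "(\<integral>x. x \<partial>\<mu>) = 0" "(\<integral>x. x\<^sup>2 \<partial>\<mu>) = \<sigma>\<^sup>2" "0 < measure \<mu> {0..}"
    and x_pos: "\<And>n. n \<ge> 1 \<Longrightarrow> 0 < x n"
    and v_lim: "filterlim (\<lambda>n. (x n)\<^sup>2 / real n) at_top sequentially"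
    and w_lim: "(\<lambda>n. x n / real n) \<longlonglongrightarrow> 0"
    and "0 \<le> t" "0 < \<eta>"
  shows "eventually (\<lambda>n. exp (- ((x n)\<^sup>2 / real n * (t\<^sup>2 / (2 * \<sigma>\<^sup>2) + \<eta>)))
    \<le> measure (conv_power (n - 1) \<mu>) {t * x n..}) sequentially"
proof -
  define v where "v = (\<lambda>n. (x n)\<^sup>2 / real n)"
  define b where "b = t / \<sigma>"
  have b: "0 \<le> b" using assms by (simp add: b_def)
  \<comment> \<open>Exponent paid per block: \<open>std_normal_tail_lower\<close> at
    \<open>a = s / \<sigma> = (L + 1) * b\<close> with the \<open>s\<close> below. There are about
    \<open>v / L\<^sup>2\<close> blocks, so the total is about \<open>v * D L / L\<^sup>2\<close>,
    and \<open>D L / L\<^sup>2\<close> tends to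
    \<open>b\<^sup>2 / 2 = t\<^sup>2 / (2 * \<sigma>\<^sup>2)\<close>.\<close>
  define D where "D = (\<lambda>L. ((L + 1) * b + 1)\<^sup>2 / 2 + 2)"
  have "((\<lambda>L. (b + (b + 1) * inverse L)\<^sup>2 / 2 + 2 * (inverse L)\<^sup>2) \<longlongrightarrow> (b + (b + 1) * 0)\<^sup>2 / 2 + 2 * 0\<^sup>2) at_top"
    by (intro tendsto_intros tendsto_inverse_0_at_top filterlim_ident) simp
  then have "eventually (\<lambda>L. (b + (b + 1) * inverse L)\<^sup>2 / 2 + 2 * (inverse L)\<^sup>2 < b\<^sup>2 / 2 + \<eta> / 3) at_top"
    using \<open>0 < \<eta>\<close> by (intro order_tendstoD) auto
  then have "eventually (\<lambda>L. 0 < L \<and> D L / L\<^sup>2 < b\<^sup>2 / 2 + \<eta> / 3) at_top"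
    using eventually_gt_at_top[of 0]
  proof eventually_elim
    case (elim L)
    have "D L / L\<^sup>2 = (b + (b + 1) * inverse L)\<^sup>2 / 2 + 2 * (inverse L)\<^sup>2"
      using elim(2) by (simp add: D_def field_simps power2_eq_square)
    then show ?case using elim by simp
  qed
  then obtain L where L: "0 < L" "D L / L\<^sup>2 < b\<^sup>2 / 2 + \<eta> / 3"
    using eventually_happens'[of "at_top :: real filter"] by auto
  have D_pos: "0 < D L" by (simp add: D_def add_nonneg_pos)
  define k where "k = (\<lambda>n. nat \<lfloor>(L * real n / x n)\<^sup>2\<rfloor>)"
  \<comment> \<open>Without rounding, \<open>L * t\<close> would be enough, since then
    \<open>m * sqrt k = x / L\<close>. The factor \<open>L + 1\<close> makes up for the incomplete
    block, which is only asked to be nonnegative.\<close>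
  define s where "s = (L + 1) * t"
  have s: "0 \<le> s" using L assms by (simp add: s_def)
  obtain c where c: "0 < c" "\<And>n. c \<le> measure (conv_power n \<mu>) {0..}"
    using conv_power_nonneg_tail_bound[OF assms(1-6)] by blast
  have "exp (- D L) < measure std_normal_distribution {s / \<sigma>..}"
    using std_normal_tail_lower[of "s / \<sigma>"] s assms by (simp add: D_def s_def b_def)
  then have "eventually (\<lambda>k. exp (- D L) < measure (conv_power k \<mu>) {s * sqrt (real k)..}) sequentially"
    using conv_power_CLT[OF assms(1-5), of s] by (intro order_tendstoD(1)) auto
  moreover have k_lim: "filterlim k at_top sequentially"
  proof -
    have "filterlim (\<lambda>n. inverse (x n / real n)) at_top sequentially"
      using w_lim by (rule filterlim_inverse_at_top)
        (use x_pos in \<open>auto intro!: eventually_mono[OF eventually_ge_at_top[of 1]]\<close>)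
    then have "filterlim (\<lambda>n. L * inverse (x n / real n)) at_top sequentially"
      using L by (intro filterlim_tendsto_pos_mult_at_top[OF tendsto_const]) auto
    then have "filterlim (\<lambda>n. (L * inverse (x n / real n))\<^sup>2) at_top sequentially"
      by (intro filterlim_pow_at_top) auto
    then have "filterlim (\<lambda>n. (L * real n / x n)\<^sup>2) at_top sequentially"
      by (simp add: field_simps)
    then show ?thesis unfolding k_def
      by (intro filterlim_compose[OF filterlim_nat_sequentially]
          filterlim_compose[OF filterlim_floor_sequentially])
  qed
  ultimately have e1: "eventually (\<lambda>n. exp (- D L) < measure (conv_power (k n) \<mu>) {s * sqrt (real (k n))..}) sequentially"
    by (rule eventually_compose_filterlim)
  have e2: "eventually (\<lambda>n. 1 \<le> k n) sequentially"
    using k_lim by (auto simp: filterlim_at_top)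
  have v_lim': "filterlim v at_top sequentially"
    unfolding v_def by (rule v_lim)
  \<comment> \<open>This makes the block length \<open>k n\<close> at most
    \<open>n / (L + 1)\<close>, so that the complete blocks cover at least the fraction
    \<open>L / (L + 1)\<close> of the summands.\<close>
  have e3: "eventually (\<lambda>n. L\<^sup>2 * (L + 1) \<le> v n) sequentially"
    using v_lim' by (auto simp: filterlim_at_top)
  \<comment> \<open>The floor in \<open>k\<close> can make blocks shorter and hence more numerous:
    their number is at most \<open>v / (L\<^sup>2 - v / n)\<close>. As \<open>v / n\<close> is the
    square of \<open>x / n\<close>, the correction vanishes.\<close>
  have "(\<lambda>n. D L / (L\<^sup>2 - (x n / real n)\<^sup>2)) \<longlonglongrightarrow> D L / (L\<^sup>2 - 0\<^sup>2)"
    using L by (intro tendsto_intros w_lim) auto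
  then have e4: "eventually (\<lambda>n. D L / (L\<^sup>2 - (x n / real n)\<^sup>2) < b\<^sup>2 / 2 + \<eta> / 3) sequentially"
    by (rule order_tendstoD) (use L in simp)
  have "(\<lambda>n. (x n / real n)\<^sup>2) \<longlonglongrightarrow> 0\<^sup>2"
    by (intro tendsto_intros w_lim)
  then have e5: "eventually (\<lambda>n. (x n / real n)\<^sup>2 < L\<^sup>2) sequentially"
    by (rule order_tendstoD) (use L in simp)
  have e6: "eventually (\<lambda>n. - ln c / (\<eta> / 3) \<le> v n) sequentially"
    using v_lim' by (auto simp: filterlim_at_top)
  from e1 e2 e3 e4 e5 e6 eventually_ge_at_top[of 1] show ?thesis
  proof eventually_elim
    case (elim n)
    define m where "m = (n - 1) div k n"
    define r where "r = (n - 1) mod k n"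
    note n = \<open>1 \<le> n\<close>
    have xn: "0 < x n" using x_pos n by simp
    have mr: "n - 1 = m * k n + r" by (simp only: m_def r_def div_mult_mod_eq)
    have r: "r < k n" using elim(2) by (simp add: r_def)
    have vn: "0 < v n" using n xn by (simp add: v_def)
    have sq: "(L * real n / x n)\<^sup>2 = L\<^sup>2 * real n / v n"
      using n xn by (simp add: v_def field_simps power2_eq_square)
    have k1: "real (k n) \<le> (L * real n / x n)\<^sup>2"
      by (simp add: k_def)
    have k2: "L\<^sup>2 * real n / v n - 1 \<le> real (k n)"
      unfolding sq[symmetric] k_def by linarith
    have w: "(x n / real n)\<^sup>2 = v n / real n"
      using n by (simp add: v_def field_simps power2_eq_square)
    have "real m * real (k n) \<le> real n"
      using mr n by (metis le_add1 le_trans diff_le_self of_nat_le_iff of_nat_mult)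
    then have "real m * (L\<^sup>2 * real n / v n - 1) \<le> real n"
      using mult_left_mono[OF k2, of "real m"] by simp
    then have "real m * (L\<^sup>2 - v n / real n) \<le> v n"
      using n vn by (simp add: field_simps)
    then have "real m \<le> v n / (L\<^sup>2 - v n / real n)"
      using elim(5) w by (simp add: pos_le_divide_eq)
    then have "real m * D L \<le> v n / (L\<^sup>2 - v n / real n) * D L"
      by (rule mult_right_mono) (use D_pos in simp)
    then have "real m * D L \<le> v n * (D L / (L\<^sup>2 - v n / real n))"
      by simp
    also have "\<dots> \<le> v n * (b\<^sup>2 / 2 + \<eta> / 3)"
      using elim(4) vn w by (intro mult_left_mono) auto
    finally have mD: "real m * D L \<le> v n * (b\<^sup>2 / 2 + \<eta> / 3)" .
    have "t * x n \<le> real m * (s * sqrt (real (k n)))"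
    proof -
      have sk: "sqrt (real (k n)) \<le> L * real n / x n"
        using k1 L n xn by (intro real_le_lsqrt) auto
      have skp: "0 < sqrt (real (k n))" using elim(2) by simp
      have "real n - real (k n) \<le> real m * real (k n)"
        using mr r n unfolding of_nat_mult[symmetric] by linarith
      moreover have "real (k n) \<le> real n / (L + 1)"
      proof -
        have "real (k n) \<le> L\<^sup>2 * real n / v n" using k1 sq by simp
        also have "\<dots> \<le> L\<^sup>2 * real n / (L\<^sup>2 * (L + 1))"
          using elim(3) L vn by (intro divide_left_mono) auto
        also have "\<dots> = real n / (L + 1)" using L by simp
        finally show ?thesis .
      qed
      moreover have "real n - real n / (L + 1) = real n * L / (L + 1)"
        using L by (simp add: field_simps)
      ultimately have "real n * L / (L + 1) \<le> real m * real (k n)" by linarith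
      also have "\<dots> = real m * sqrt (real (k n)) * sqrt (real (k n))" by simp
      also have "\<dots> \<le> real m * sqrt (real (k n)) * (L * real n / x n)"
        using sk skp by (intro mult_left_mono) auto
      finally have "(real n * L) * (1 / (L + 1)) \<le> (real n * L) * (real m * sqrt (real (k n)) / x n)"
        by (simp add: mult_ac)
      then have "1 / (L + 1) \<le> real m * sqrt (real (k n)) / x n"
        by (rule mult_left_le_imp_le) (use L n in simp)
      then have "x n \<le> (L + 1) * (real m * sqrt (real (k n)))"
        using L xn by (simp add: divide_le_eq le_divide_eq mult_ac)
      then have "t * x n \<le> t * ((L + 1) * (real m * sqrt (real (k n))))"
        using \<open>0 \<le> t\<close> by (rule mult_left_mono)
      also have "\<dots> = real m * (s * sqrt (real (k n)))" by (simp add: s_def)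
      finally show ?thesis .
    qed
    then have mono: "measure (conv_power (n - 1) \<mu>) {real m * (s * sqrt (real (k n))) + 0..}
        \<le> measure (conv_power (n - 1) \<mu>) {t * x n..}"
      by (intro finite_measure.finite_measure_mono)
        (auto simp: finite_measure_real_distribution sets_real_distribution real_distribution_conv_power assms(1))
    \<comment> \<open>Since \<open>v\<close> tends to infinity, the constant factor \<open>c\<close>
      of the incomplete block costs at most one third of \<eta>; another third was spent on the
      complete blocks.\<close>
    have "- ln c \<le> v n * (\<eta> / 3)"
      using elim(6) \<open>0 < \<eta>\<close> pos_divide_le_eq[of "\<eta> / 3" "- ln c" "v n"] by simp
    then have "exp (- (v n * (\<eta> / 3))) \<le> c"
      using c(1) ln_ge_iff[of c "- (v n * (\<eta> / 3))"] by linarith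
    moreover have "v n * (b\<^sup>2 / 2 + \<eta>) = v n * (b\<^sup>2 / 2 + \<eta> / 3) + v n * (\<eta> / 3) + v n * (\<eta> / 3)"
      by (simp add: algebra_simps)
    moreover have "0 \<le> v n * (\<eta> / 3)" using vn \<open>0 < \<eta>\<close> by simp
    ultimately have "exp (- (v n * (b\<^sup>2 / 2 + \<eta>))) \<le> exp (- (real m * D L)) * exp (- (v n * (\<eta> / 3)))"
      using mD unfolding exp_add[symmetric] exp_le_cancel_iff by linarith
    also have "\<dots> \<le> exp (- (real m * D L)) * c"
      using \<open>exp (- (v n * (\<eta> / 3))) \<le> c\<close> by simp
    also have "\<dots> = exp (- D L) ^ m * c"
      using exp_of_nat_mult[of m "- D L"] by simp
    also have "\<dots> \<le> measure (conv_power (k n) \<mu>) {s * sqrt (real (k n))..} ^ m * measure (conv_power r \<mu>) {0..}"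
      using elim(1) c by (intro mult_mono power_mono) (auto simp: less_imp_le)
    also have "\<dots> \<le> measure (conv_power (m * k n) \<mu>) {real m * (s * sqrt (real (k n)))..} * measure (conv_power r \<mu>) {0..}"
      by (rule mult_right_mono[OF conv_power_mult_ge[OF assms(1)]]) simp
    also have "\<dots> \<le> measure (conv_power (n - 1) \<mu>) {real m * (s * sqrt (real (k n))) + 0..}"
      unfolding mr by (rule conv_power_add_ge[OF assms(1)])
    also have "\<dots> \<le> measure (conv_power (n - 1) \<mu>) {t * x n..}"
      by (rule mono)
    finally show ?case
      by (simp add: v_def b_def power_divide mult.commute)
  qed
qed

section \<open>Ingredients of the exponential Markov bound\<close>

text \<open>Markov's inequality for a product whose expectation factorises by independence, followed
  by \<open>1 + a \<le> exp a\<close>. A general nonnegative \<open>f\<close> is allowed because the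
  exponent used later is not linear.\<close>

lemma (in prob_space) chernoff_iid:
  fixes f :: "real \<Rightarrow> real"
  assumes "finite I" "indep_vars (\<lambda>_. borel) Y I" "\<And>i. i \<in> I \<Longrightarrow> distr M borel (Y i) = \<mu>"
    and f: "f \<in> borel_measurable borel" "\<And>y. 0 \<le> f y" "integrable \<mu> f" "(\<integral>y. f y \<partial>\<mu>) \<le> 1 + a"
  shows "prob {\<omega> \<in> space M. exp s \<le> (\<Prod>i\<in>I. f (Y i \<omega>))} \<le> exp (real (card I) * a - s)"
proof -
  have rv: "random_variable borel (Y i)" if "i \<in> I" for i
    using assms(2) that by (auto simp: indep_vars_def)
  have ind: "indep_vars (\<lambda>_. borel) (\<lambda>i \<omega>. f (Y i \<omega>)) I"
    using assms(2) f(1) by (rule indep_vars_compose2)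
  have int: "integrable M (\<lambda>\<omega>. f (Y i \<omega>))" if "i \<in> I" for i
    using integrable_distr_eq[OF rv[OF that] f(1)] f(3) assms(3)[OF that] by simp
  have e: "expectation (\<lambda>\<omega>. f (Y i \<omega>)) = (\<integral>y. f y \<partial>\<mu>)" if "i \<in> I" for i
    using integral_distr[OF rv[OF that] f(1)] assms(3)[OF that] by simp
  have "prob {\<omega> \<in> space M. exp s \<le> (\<Prod>i\<in>I. f (Y i \<omega>))} \<le> expectation (\<lambda>\<omega>. \<Prod>i\<in>I. f (Y i \<omega>)) / exp s"
  proof (rule integral_Markov_inequality_measure[where A = "space M"])
    show "integrable M (\<lambda>\<omega>. \<Prod>i\<in>I. f (Y i \<omega>))"
      by (rule indep_vars_integrable[OF assms(1) ind int])
  qed (auto intro!: prod_nonneg f AE_I2)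
  also have "expectation (\<lambda>\<omega>. \<Prod>i\<in>I. f (Y i \<omega>)) = (\<Prod>i\<in>I. expectation (\<lambda>\<omega>. f (Y i \<omega>)))"
    by (rule indep_vars_lebesgue_integral[OF assms(1) ind int])
  also have "\<dots> = (\<integral>y. f y \<partial>\<mu>) ^ card I"
    by (simp add: e)
  also have "\<dots> \<le> exp a ^ card I"
  proof (rule power_mono)
    show "(\<integral>y. f y \<partial>\<mu>) \<le> exp a" using f(4) exp_ge_add_one_self[of a] by linarith
  qed (simp add: f)
  also have "exp a ^ card I / exp s = exp (real (card I) * a - s)"
    by (simp add: exp_diff exp_of_nat_mult)
  finally show ?thesis by (simp add: divide_right_mono)
qed

text \<open>For \<open>\<bar>y\<bar> \<le> 1\<close> the third-order Taylor term is at most the cube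
  of \<open>\<bar>y\<bar>\<close>. For \<open>y < -1\<close> the left side is at most 1, and
  \<open>y + 3/2 * y\<^sup>2\<close> is nonnegative. The minimum keeps the error below
  \<open>y\<^sup>2\<close>, so that it stays integrable on the negative side.\<close>

lemma exp_le_quadratic_plus_remainder:
  fixes y :: real
  assumes "y \<le> 1"
  shows "exp y \<le> 1 + y + y\<^sup>2 / 2 + y\<^sup>2 * min 1 \<bar>y\<bar>"
proof (cases "-1 \<le> y")
  case True
  obtain t where t: "\<bar>t\<bar> \<le> \<bar>y\<bar>" "exp y = (\<Sum>m<3. y ^ m / fact m) + exp t / fact 3 * y ^ 3"
    using Maclaurin_exp_le[of y 3] by auto
  have "exp t \<le> exp 1" using t True assms by simp
  also have "\<dots> \<le> 3" using exp_le by simp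
  finally have "exp t / 6 \<le> 1" by simp
  have "exp t / 6 * y ^ 3 \<le> \<bar>exp t / 6 * y ^ 3\<bar>" by simp
  also have "\<dots> = exp t / 6 * \<bar>y\<bar> ^ 3" by (simp add: abs_mult power_abs)
  also have "\<dots> \<le> 1 * \<bar>y\<bar> ^ 3" using \<open>exp t / 6 \<le> 1\<close> by (intro mult_right_mono) auto
  also have "\<dots> = y\<^sup>2 * min 1 \<bar>y\<bar>" using True assms by (simp add: min_def power3_eq_cube power2_eq_square abs_if)
  finally show ?thesis using t(2) by (simp add: eval_nat_numeral lessThan_Suc)
next
  case False
  have "exp y \<le> 1" using False by simp
  moreover have "0 \<le> y * (1 + 3 / 2 * y)" using False by (intro mult_nonpos_nonpos) auto
  moreover have "y\<^sup>2 * min 1 \<bar>y\<bar> = y\<^sup>2" using False by (simp add: min_def)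
  moreover have "y * (1 + 3 / 2 * y) = y + y\<^sup>2 / 2 + y\<^sup>2"
    by (simp add: algebra_simps power2_eq_square)
  ultimately show ?thesis by linarith
qed

text \<open>Dividing by the sum reduces this to \<open>u \<le> u powr p\<close> for \<open>u\<close>
  in [0,1]. It expresses that sharing a large total among several big summands is no cheaper than
  putting it into one.\<close>

lemma powr_sum_le:
  fixes p :: real and y :: "'i \<Rightarrow> real"
  assumes "finite I" "p \<le> 1" "\<And>i. i \<in> I \<Longrightarrow> 0 \<le> y i"
  shows "(\<Sum>i\<in>I. y i) powr p \<le> (\<Sum>i\<in>I. y i powr p)"
proof (cases "(\<Sum>i\<in>I. y i) = 0")
  case True
  then show ?thesis by (simp add: sum_nonneg)
next
  case False
  define S where "S = (\<Sum>i\<in>I. y i)"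
  have S: "0 < S" using False assms by (simp add: S_def sum_nonneg order_less_le)
  have "y i / S * S powr p \<le> y i powr p" if "i \<in> I" for i
  proof (cases "y i = 0")
    case False
    have y: "0 < y i" "y i \<le> S"
      using False assms that by (auto simp: S_def order_less_le intro!: member_le_sum)
    have "(y i / S) powr 1 \<le> (y i / S) powr p"
      using y S assms by (intro powr_mono') auto
    then have "y i / S \<le> y i powr p / S powr p"
      using y S by (simp add: powr_divide)
    then show ?thesis using S by (simp add: le_divide_eq)
  qed simp
  then have "(\<Sum>i\<in>I. y i / S * S powr p) \<le> (\<Sum>i\<in>I. y i powr p)"
    by (rule sum_mono)
  moreover have "(\<Sum>i\<in>I. y i / S * S powr p) = S powr p"
    using S by (simp add: sum_distrib_right[symmetric] sum_divide_distrib[symmetric] flip: S_def)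
  ultimately show ?thesis by (simp add: S_def)
qed

text \<open>The integrated error of the quadratic expansion at \<open>\<theta> * y\<close>, with
  \<open>\<theta>\<^sup>2\<close> taken out. Its integrand is dominated by \<open>y\<^sup>2\<close>,
  which yields convergence to 0 as \<theta> tends to 0.\<close>

definition square_remainder :: "real measure \<Rightarrow> real \<Rightarrow> real" where
  "square_remainder \<mu> \<theta> = (\<integral>y. y\<^sup>2 * min 1 \<bar>\<theta> * y\<bar> \<partial>\<mu>)"

lemma integrable_square_min:
  assumes "real_distribution \<mu>" "integrable \<mu> (\<lambda>y. y\<^sup>2)"
  shows "integrable \<mu> (\<lambda>y. y\<^sup>2 * min 1 \<bar>\<theta> * y\<bar>)"
proof (rule Bochner_Integration.integrable_bound[OF assms(2)])
  have [measurable_cong]: "sets \<mu> = sets borel" by (rule sets_real_distribution[OF assms(1)])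
  show "(\<lambda>y. y\<^sup>2 * min 1 \<bar>\<theta> * y\<bar>) \<in> borel_measurable \<mu>" by measurable
qed (auto simp: abs_mult intro!: AE_I2 mult_left_le)

lemma square_remainder_mono:
  assumes "real_distribution \<mu>" "integrable \<mu> (\<lambda>y. y\<^sup>2)" "0 \<le> \<theta>" "\<theta> \<le> \<theta>'"
  shows "square_remainder \<mu> \<theta> \<le> square_remainder \<mu> \<theta>'"
  unfolding square_remainder_def
proof (rule integral_mono)
  fix y
  have "\<bar>\<theta> * y\<bar> \<le> \<bar>\<theta>' * y\<bar>" using assms by (simp add: abs_mult mult_right_mono)
  then show "y\<^sup>2 * min 1 \<bar>\<theta> * y\<bar> \<le> y\<^sup>2 * min 1 \<bar>\<theta>' * y\<bar>"
    by (intro mult_left_mono min.mono) auto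
qed (intro integrable_square_min assms)+

lemma square_remainder_tendsto_zero:
  assumes "real_distribution \<mu>" "integrable \<mu> (\<lambda>y. y\<^sup>2)" "\<theta> \<longlonglongrightarrow> 0"
  shows "(\<lambda>n. square_remainder \<mu> (\<theta> n)) \<longlonglongrightarrow> 0"
proof -
  have [measurable_cong]: "sets \<mu> = sets borel" by (rule sets_real_distribution[OF assms(1)])
  have "(\<lambda>n. \<integral>y. y\<^sup>2 * min 1 \<bar>\<theta> n * y\<bar> \<partial>\<mu>) \<longlonglongrightarrow> (\<integral>y. 0 \<partial>\<mu>)"
  proof (rule integral_dominated_convergence[OF _ _ assms(2)])
    have "(\<lambda>n. y\<^sup>2 * min 1 \<bar>\<theta> n * y\<bar>) \<longlonglongrightarrow> y\<^sup>2 * min 1 \<bar>0 * y\<bar>" for y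
      by (intro tendsto_intros assms)
    then show "AE y in \<mu>. (\<lambda>n. y\<^sup>2 * min 1 \<bar>\<theta> n * y\<bar>) \<longlonglongrightarrow> 0" by simp
  qed (auto simp: abs_mult intro!: AE_I2 mult_left_le)
  then show ?thesis by (simp add: square_remainder_def)
qed

text \<open>Slice according to the integer part \<open>k\<close> of \<open>y powr p\<close>. The
  slice contributes at most \<open>exp (r * (k + 1))\<close> times the tail at
  \<open>k powr (1 / p)\<close>, which is eventually at most \<open>exp (- q * k)\<close>; the
  comparison series is geometric with ratio \<open>exp (r - q) < 1\<close>.\<close>

lemma integrable_exp_powr:
  assumes "real_distribution \<mu>" "0 < p" "0 \<le> r" "r < q"
    and "eventually (\<lambda>y. measure \<mu> {y..} \<le> exp (- q * y powr p)) at_top"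
  shows "integrable \<mu> (\<lambda>y. exp (r * y powr p) * indicator {0<..} y)"
proof (rule integrableI_nonneg)
  interpret \<mu>: real_distribution \<mu> by fact
  have m[measurable_cong]: "sets \<mu> = sets borel" by simp
  show "(\<lambda>y. exp (r * y powr p) * indicator {0<..} y) \<in> borel_measurable \<mu>" by measurable
  define a where "a = (\<lambda>k. exp (r * (real k + 1)) * measure \<mu> {real k powr (1 / p)..})"
  have "(\<integral>\<^sup>+y. ennreal (exp (r * y powr p) * indicator {0<..} y) \<partial>\<mu>)
      \<le> (\<integral>\<^sup>+y. (\<Sum>k. ennreal (exp (r * (real k + 1))) * indicator {real k powr (1 / p)..} y) \<partial>\<mu>)"
  proof (rule nn_integral_mono)
    fix y :: real
    show "ennreal (exp (r * y powr p) * indicator {0<..} y)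
        \<le> (\<Sum>k. ennreal (exp (r * (real k + 1))) * indicator {real k powr (1 / p)..} y)"
    proof (cases "0 < y")
      case True
      define k where "k = nat \<lfloor>y powr p\<rfloor>"
      have k: "real k \<le> y powr p" "y powr p \<le> real k + 1"
        using powr_ge_zero[of y p] unfolding k_def by linarith+
      have "real k powr (1 / p) \<le> (y powr p) powr (1 / p)"
        using k assms(2) by (intro powr_mono2) auto
      also have "\<dots> = y" using assms(2) True by (simp add: powr_powr)
      finally have ky: "real k powr (1 / p) \<le> y" .
      have "exp (r * y powr p) \<le> exp (r * (real k + 1))"
        using k assms by (simp add: mult_left_mono)
      then have "ennreal (exp (r * y powr p) * indicator {0<..} y)
          \<le> (\<Sum>k\<in>{k}. ennreal (exp (r * (real k + 1))) * indicator {real k powr (1 / p)..} y)"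
        using True ky by (simp add: ennreal_leI)
      also have "\<dots> \<le> (\<Sum>k. ennreal (exp (r * (real k + 1))) * indicator {real k powr (1 / p)..} y)"
        by (rule sum_le_suminf) auto
      finally show ?thesis .
    qed simp
  qed
  also have "\<dots> = (\<Sum>k. ennreal (a k))"
    by (subst nn_integral_suminf)
      (auto simp: a_def nn_integral_cmult_indicator \<mu>.emeasure_eq_measure ennreal_mult)
  also have "\<dots> < \<infinity>"
  proof -
    have "filterlim (\<lambda>k. real k powr (1 / p)) at_top sequentially"
      using assms(2) by real_asymp
    then have "eventually (\<lambda>k. measure \<mu> {real k powr (1 / p)..} \<le> exp (- q * (real k powr (1 / p)) powr p)) sequentially"
      using assms(5) by (rule eventually_compose_filterlim[rotated])
    then have "eventually (\<lambda>k. norm (a k) \<le> exp r * exp (r - q) ^ k) sequentially"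
      using eventually_ge_at_top[of 1]
    proof eventually_elim
      case (elim k)
      have "a k \<le> exp (r * (real k + 1)) * exp (- q * real k)"
        unfolding a_def using elim assms(2) by (intro mult_left_mono) (auto simp: powr_powr)
      also have "\<dots> = exp r * exp (r - q) ^ k"
        by (simp add: exp_of_nat_mult[symmetric] exp_add[symmetric] algebra_simps)
      finally show ?case by (simp add: a_def)
    qed
    moreover have "summable (\<lambda>k. exp r * exp (r - q) ^ k)"
      using assms(4) by (intro summable_mult summable_geometric) simp
    ultimately have "summable a"
      by (rule summable_comparison_test_ev)
    then show ?thesis
      by (subst suminf_ennreal2) (auto simp: a_def)
  qed
  finally show "(\<integral>\<^sup>+y. ennreal (exp (r * y powr p) * indicator {0<..} y) \<partial>\<mu>) < \<infinity>" .
qed auto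

definition exp_tail_moment :: "real measure \<Rightarrow> real \<Rightarrow> real \<Rightarrow> real \<Rightarrow> real" where
  "exp_tail_moment \<mu> q p T = (\<integral>y. exp (q * y powr p) * indicator {T<..} y \<partial>\<mu>)"

lemma integrable_exp_tail:
  assumes "real_distribution \<mu>" "integrable \<mu> (\<lambda>y. exp (q * y powr p) * indicator {0<..} y)" "0 \<le> T"
  shows "integrable \<mu> (\<lambda>y. exp (q * y powr p) * indicator {T<..} y)"
proof (rule Bochner_Integration.integrable_bound[OF assms(2)])
  have [measurable_cong]: "sets \<mu> = sets borel" by (rule sets_real_distribution[OF assms(1)])
  show "(\<lambda>y. exp (q * y powr p) * indicator {T<..} y) \<in> borel_measurable \<mu>" by measurable
qed (use assms(3) in \<open>auto intro!: AE_I2 split: split_indicator\<close>)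

text \<open>The gap between the exponents \<open>q\<close> and \<open>r\<close> is traded for decay
  in \<open>T\<close>. With \<open>T\<close> a positive power of \<open>n\<close>, the decay beats
  the factor \<open>n\<close> from the number of summands.\<close>

lemma exp_tail_moment_le:
  assumes "real_distribution \<mu>" "integrable \<mu> (\<lambda>y. exp (r * y powr p) * indicator {0<..} y)" 
    and "q \<le> r" "0 < p" "0 \<le> T"
  shows "exp_tail_moment \<mu> q p T
    \<le> exp (- (r - q) * T powr p) * (\<integral>y. exp (r * y powr p) * indicator {0<..} y \<partial>\<mu>)"
proof -
  have [measurable_cong]: "sets \<mu> = sets borel" by (rule sets_real_distribution[OF assms(1)])
  have le: "exp (q * y powr p) * indicator {T<..} y
      \<le> exp (- (r - q) * T powr p) * (exp (r * y powr p) * indicator {0<..} y)" for y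
  proof (cases "T < y")
    case True
    have "(r - q) * T powr p \<le> (r - q) * y powr p"
      using True assms by (intro mult_left_mono powr_mono2) auto
    then have "exp (q * y powr p) \<le> exp (- (r - q) * T powr p + r * y powr p)"
      by (simp add: algebra_simps)
    then show ?thesis using True assms(5) by (simp add: exp_add)
  qed simp
  have "exp_tail_moment \<mu> q p T
      \<le> (\<integral>y. exp (- (r - q) * T powr p) * (exp (r * y powr p) * indicator {0<..} y) \<partial>\<mu>)"
    unfolding exp_tail_moment_def
  proof (rule integral_mono)
    show i: "integrable \<mu> (\<lambda>y. exp (- (r - q) * T powr p) * (exp (r * y powr p) * indicator {0<..} y))"
      by (rule integrable_mult_right[OF assms(2)])
    show "integrable \<mu> (\<lambda>y. exp (q * y powr p) * indicator {T<..} y)"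
      by (rule Bochner_Integration.integrable_bound[OF i])
        (use le in \<open>auto intro!: AE_I2 simp: abs_mult\<close>)
  qed (rule le)
  then show ?thesis by simp
qed

section \<open>The mixed linear and concave exponent, and the resulting bound for fixed
  \<open>n\<close>\<close>

definition tilt :: "real \<Rightarrow> real \<Rightarrow> real \<Rightarrow> real \<Rightarrow> real \<Rightarrow> real" where
  "tilt \<theta> b q p y = (if y \<le> b then \<theta> * y else q * y powr p)"

lemma tilt_measurable[measurable]: "tilt \<theta> b q p \<in> borel_measurable borel"
  unfolding tilt_def by measurable

text \<open>Up to \<open>T\<close> the exponent \<open>\<theta> * y\<close> is at most 1 and is
  expanded to second order; the mean being 0, only the variance and the remainder survive. Beyond
  \<open>T\<close> both branches of \<open>tilt\<close> are at most \<open>q * y powr p\<close>,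
  whose contribution is the exponential tail moment.\<close>

lemma exp_tilt_moment:
  assumes "real_distribution \<mu>" "integrable \<mu> (\<lambda>y. y\<^sup>2)"
    and "(\<integral>y. y \<partial>\<mu>) = 0" "(\<integral>y. y\<^sup>2 \<partial>\<mu>) = \<sigma>\<^sup>2"
    and "integrable \<mu> (\<lambda>y. exp (q * y powr p) * indicator {0<..} y)"
    and "0 \<le> \<theta>" "0 < T" "T \<le> b" "\<theta> * T \<le> 1" "\<And>y. T < y \<Longrightarrow> y \<le> b \<Longrightarrow> \<theta> * y \<le> q * y powr p"
  shows "integrable \<mu> (\<lambda>y. exp (tilt \<theta> b q p y))"
    and "(\<integral>y. exp (tilt \<theta> b q p y) \<partial>\<mu>)
      \<le> 1 + (\<theta>\<^sup>2 * (\<sigma>\<^sup>2 / 2 + square_remainder \<mu> \<theta>) + exp_tail_moment \<mu> q p T)"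
proof -
  interpret \<mu>: real_distribution \<mu> by fact
  let ?g = "\<lambda>y. 1 + \<theta> * y + \<theta>\<^sup>2 / 2 * y\<^sup>2 + \<theta>\<^sup>2 * (y\<^sup>2 * min 1 \<bar>\<theta> * y\<bar>)"
  let ?h = "\<lambda>y. exp (q * y powr p) * indicator {T<..} y"
  have int1: "integrable \<mu> (\<lambda>y. y)"
    by (rule \<mu>.square_integrable_imp_integrable[OF _ assms(2)]) simp
  have intm: "integrable \<mu> (\<lambda>y. y\<^sup>2 * min 1 \<bar>\<theta> * y\<bar>)"
    by (rule integrable_square_min[OF assms(1,2)])
  have inth: "integrable \<mu> ?h"
    by (rule integrable_exp_tail[OF assms(1,5)]) (use assms(7) in simp)
  have intg: "integrable \<mu> ?g"
    using int1 intm assms(2) by (intro Bochner_Integration.integrable_add integrable_mult_right) auto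
  \<comment> \<open>The quadratic majorant is integrated over the whole line and the tail term is
    added to it, so it must not be negative beyond \<open>T\<close>.\<close>
  have g_nonneg: "0 \<le> ?g y" for y
  proof -
    have "1 + \<theta> * y + \<theta>\<^sup>2 / 2 * y\<^sup>2 = ((1 + \<theta> * y)\<^sup>2 + 1) / 2"
      by (simp add: power2_eq_square field_simps)
    moreover have "0 \<le> ((1 + \<theta> * y)\<^sup>2 + 1) / 2" by simp
    moreover have "0 \<le> \<theta>\<^sup>2 * (y\<^sup>2 * min 1 \<bar>\<theta> * y\<bar>)" by simp
    ultimately show ?thesis by linarith
  qed
  have le: "exp (tilt \<theta> b q p y) \<le> ?g y + ?h y" for y
  proof (cases "y \<le> T")
    case True
    have "\<theta> * y \<le> \<theta> * T" using True assms(6) by (intro mult_left_mono) auto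
    then have "exp (\<theta> * y) \<le> 1 + \<theta> * y + (\<theta> * y)\<^sup>2 / 2 + (\<theta> * y)\<^sup>2 * min 1 \<bar>\<theta> * y\<bar>"
      using assms(9) by (intro exp_le_quadratic_plus_remainder) simp
    then show ?thesis using True assms(8) by (simp add: tilt_def power_mult_distrib mult.assoc)
  next
    case False
    then have "tilt \<theta> b q p y \<le> q * y powr p"
      using assms(10)[of y] by (auto simp: tilt_def)
    then have "exp (tilt \<theta> b q p y) \<le> ?h y" using False by simp
    then show ?thesis using g_nonneg[of y] by linarith
  qed
  show int: "integrable \<mu> (\<lambda>y. exp (tilt \<theta> b q p y))"
  proof (rule Bochner_Integration.integrable_bound[OF Bochner_Integration.integrable_add[OF intg inth]])
    show "AE y in \<mu>. norm (exp (tilt \<theta> b q p y)) \<le> norm (?g y + ?h y)"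
    proof (rule AE_I2)
      fix y show "norm (exp (tilt \<theta> b q p y)) \<le> norm (?g y + ?h y)"
        using le[of y] abs_ge_self[of "?g y + ?h y"] unfolding real_norm_def abs_exp_cancel by linarith
    qed
  qed measurable
  have "(\<integral>y. exp (tilt \<theta> b q p y) \<partial>\<mu>) \<le> (\<integral>y. ?g y + ?h y \<partial>\<mu>)"
    by (rule integral_mono[OF int Bochner_Integration.integrable_add[OF intg inth] le])
  also have "\<dots> = (\<integral>y. ?g y \<partial>\<mu>) + (\<integral>y. ?h y \<partial>\<mu>)"
    by (rule Bochner_Integration.integral_add[OF intg inth])
  also have "(\<integral>y. ?g y \<partial>\<mu>) = 1 + \<theta>\<^sup>2 * (\<sigma>\<^sup>2 / 2 + square_remainder \<mu> \<theta>)"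
  proof -
    have "(\<integral>y. ?g y \<partial>\<mu>) = 1 + \<theta> * (\<integral>y. y \<partial>\<mu>) + \<theta>\<^sup>2 / 2 * (\<integral>y. y\<^sup>2 \<partial>\<mu>)
        + \<theta>\<^sup>2 * (\<integral>y. y\<^sup>2 * min 1 \<bar>\<theta> * y\<bar> \<partial>\<mu>)"
      using int1 intm assms(2) \<mu>.prob_space by simp
    then show ?thesis
      by (simp add: assms(3,4) square_remainder_def distrib_left)
  qed
  finally show "(\<integral>y. exp (tilt \<theta> b q p y) \<partial>\<mu>)
      \<le> 1 + (\<theta>\<^sup>2 * (\<sigma>\<^sup>2 / 2 + square_remainder \<mu> \<theta>) + exp_tail_moment \<mu> q p T)"
    by (simp add: exp_tail_moment_def)
qed

text \<open>With \<open>A\<close> and \<open>B\<close> the contributions of the small and the large summands to \<open>\<Sum>y / x\<close>,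
  the optimal slope for \<open>t = 1 - B \<le> A\<close> is \<open>t / \<sigma>\<^sup>2\<close>; rounding it to the grid \<open>j / (K \<sigma>\<^sup>2)\<close>
  costs at most \<open>1 / (2 K\<^sup>2 \<sigma>\<^sup>2)\<close>.\<close>
lemma sum_tilt_ge:
  fixes y :: "'i \<Rightarrow> real"
  assumes "finite I" "0 < x" "0 < v" "0 < b" "0 < p" "p \<le> 1" "0 < q" "0 < \<sigma>" "1 \<le> K"
    and "x \<le> (\<Sum>i\<in>I. y i)"
    and J: "\<And>t. 0 \<le> t \<Longrightarrow> t \<le> 1 \<Longrightarrow> v * J \<le> q * (x * (1 - t)) powr p + v * t\<^sup>2 / (2 * \<sigma>\<^sup>2)"
  obtains j where "j \<le> K"
    "v * (J - 1 / (2 * (real K)\<^sup>2 * \<sigma>\<^sup>2)) + v * (real j / (real K * \<sigma>\<^sup>2))\<^sup>2 * \<sigma>\<^sup>2 / 2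
      \<le> (\<Sum>i\<in>I. tilt (real j / (real K * \<sigma>\<^sup>2) * v / x) b q p (y i))"
proof -
  note basic = assms(1-10)
  define A where "A = (\<Sum>i\<in>{i\<in>I. y i \<le> b}. y i) / x"
  define B where "B = (\<Sum>i\<in>{i\<in>I. \<not> y i \<le> b}. y i) / x"
  have sumAB: "1 \<le> A + B"
  proof -
    have "(\<Sum>i\<in>I. y i) = x * A + x * B"
      unfolding A_def B_def using basic sum.inter_filter[of I]
      by (simp add: sum.If_cases[of I "\<lambda>i. y i \<le> b" y y, simplified] Int_def Compl_eq)
    then have "x * 1 \<le> x * (A + B)" using basic by (simp add: algebra_simps)
    then show ?thesis using basic by (simp only: mult_le_cancel_left_pos)
  qed
  have B0: "0 \<le> B" unfolding B_def using basic by (intro divide_nonneg_pos sum_nonneg) auto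
  \<comment> \<open>Subadditivity of the power merges all summands above \<open>b\<close> into the
    single quantity \<open>x * B\<close>.\<close>
  have tilt_sum: "\<theta> * (x * A) + q * (x * B) powr p \<le> (\<Sum>i\<in>I. tilt \<theta> b q p (y i))" for \<theta>
  proof -
    have "(\<Sum>i\<in>I. tilt \<theta> b q p (y i))
        = (\<Sum>i\<in>{i\<in>I. y i \<le> b}. \<theta> * y i) + (\<Sum>i\<in>{i\<in>I. \<not> y i \<le> b}. q * y i powr p)"
      unfolding tilt_def using basic by (subst sum.If_cases) (auto simp: Int_def Compl_eq)
    moreover have "(x * B) powr p \<le> (\<Sum>i\<in>{i\<in>I. \<not> y i \<le> b}. y i powr p)"
      using powr_sum_le[of "{i\<in>I. \<not> y i \<le> b}" p y] basic by (simp add: B_def)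
    ultimately show ?thesis
      using basic by (simp add: sum_distrib_left[symmetric] A_def)
  qed
  define c where "c = 1 / (2 * (real K)\<^sup>2 * \<sigma>\<^sup>2)"
  have c: "0 \<le> v * c" using basic by (simp add: c_def)
  show ?thesis
  proof (cases "1 \<le> B")
    \<comment> \<open>The large summands alone reach \<open>x\<close>, so slope 0 is enough, and the
      bound on \<open>J\<close> is used at \<open>t = 0\<close>.\<close>
    case True
    have "v * J \<le> q * x powr p" using J[of 0] by simp
    also have "\<dots> \<le> q * (x * B) powr p"
      using True basic by (intro mult_left_mono powr_mono2) auto
    also have "\<dots> \<le> (\<Sum>i\<in>I. tilt 0 b q p (y i))" using tilt_sum[of 0] by simp
    finally show ?thesis
      using that[of 0] c by (simp add: c_def algebra_simps)
  next
    case False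
    define t where "t = 1 - B"
    have t: "0 \<le> t" "t \<le> 1" "t \<le> A" using False B0 sumAB by (auto simp: t_def)
    define j where "j = nat \<lfloor>real K * t\<rfloor>"
    define l where "l = real j / (real K * \<sigma>\<^sup>2)"
    have j: "real j \<le> real K * t" "real K * t \<le> real j + 1"
      using t by (simp_all add: j_def)
    have "real K * t \<le> real K" using t by (simp add: mult_left_le)
    then have jK: "j \<le> K" using j by simp
    have l: "0 \<le> l" by (simp add: l_def)
    have "l * \<sigma>\<^sup>2 = real j / real K" using basic by (simp add: l_def)
    moreover have "\<bar>t - real j / real K\<bar> \<le> 1 / real K"
    proof -
      have K: "0 < real K" using basic(9) by simp
      have "real j / real K \<le> t" "t \<le> (real j + 1) / real K"
        using j by (simp_all add: pos_divide_le_eq[OF K] pos_le_divide_eq[OF K] mult.commute)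
      then show ?thesis by (simp add: add_divide_distrib)
    qed
    ultimately have "\<bar>t - l * \<sigma>\<^sup>2\<bar> \<le> 1 / real K" by simp
    then have "(t - l * \<sigma>\<^sup>2)\<^sup>2 \<le> (1 / real K)\<^sup>2"
      by (metis power2_abs power_mono abs_ge_zero)
    then have "(t - l * \<sigma>\<^sup>2)\<^sup>2 / (2 * \<sigma>\<^sup>2) \<le> (1 / real K)\<^sup>2 / (2 * \<sigma>\<^sup>2)"
      by (rule divide_right_mono) simp
    also have "\<dots> = c" by (simp add: c_def power_divide field_simps)
    \<comment> \<open>Completing the square: \<open>l * t - l\<^sup>2 * \<sigma>\<^sup>2 / 2\<close>
      falls short of its maximum \<open>t\<^sup>2 / (2 * \<sigma>\<^sup>2)\<close> by exactly the
      squared distance of \<open>l * \<sigma>\<^sup>2\<close> from \<open>t\<close>, scaled.\<close>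
    also have "(t - l * \<sigma>\<^sup>2)\<^sup>2 / (2 * \<sigma>\<^sup>2) = t\<^sup>2 / (2 * \<sigma>\<^sup>2) - l * t + l\<^sup>2 * \<sigma>\<^sup>2 / 2"
      using basic by (simp add: field_simps power2_eq_square)
    finally have "v * (t\<^sup>2 / (2 * \<sigma>\<^sup>2) - l * t + l\<^sup>2 * \<sigma>\<^sup>2 / 2) \<le> v * c"
      using basic by (intro mult_left_mono) auto
    moreover have "v * J \<le> q * (x * B) powr p + v * t\<^sup>2 / (2 * \<sigma>\<^sup>2)"
      using J[OF t(1,2)] by (simp add: t_def)
    moreover have "v * (l * t) \<le> v * (l * A)"
      using t l basic by (intro mult_left_mono) auto
    moreover have "(l * v / x) * (x * A) = v * (l * A)" using basic by simp
    ultimately have "v * (J - c) + v * l\<^sup>2 * \<sigma>\<^sup>2 / 2 \<le> (l * v / x) * (x * A) + q * (x * B) powr p"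
      by (simp add: algebra_simps)
    also have "\<dots> \<le> (\<Sum>i\<in>I. tilt (l * v / x) b q p (y i))" by (rule tilt_sum)
    finally show ?thesis
      using that[OF jK] by (simp add: c_def l_def)
  qed
qed

text \<open>\<open>sum_tilt_ge\<close> covers the event by \<open>K + 1\<close> events, one per
  slope on the grid, and each is bounded by \<open>chernoff_iid\<close>. The term quadratic in the
  slope that was kept in \<open>sum_tilt_ge\<close> cancels the Gaussian part of the exponential
  moment, so the bound is the same for every slope.\<close>

lemma (in prob_space) iid_sum_tail_le:
  assumes "real_distribution \<mu>" "0 < \<sigma>" "integrable \<mu> (\<lambda>y. y\<^sup>2)"
    and "(\<integral>y. y \<partial>\<mu>) = 0" "(\<integral>y. y\<^sup>2 \<partial>\<mu>) = \<sigma>\<^sup>2"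
    and "0 < p" "p \<le> 1" "0 < q" "integrable \<mu> (\<lambda>y. exp (q * y powr p) * indicator {0<..} y)"
    and I: "finite I" "I \<noteq> {}" "indep_vars (\<lambda>_. borel) Y I" "\<And>i. i \<in> I \<Longrightarrow> distr M borel (Y i) = \<mu>"
    and n: "n = real (card I)" and "0 < x" and v: "v = x\<^sup>2 / n"
    and T: "0 < T" "T \<le> b" "x / (n * \<sigma>\<^sup>2) * T \<le> 1"
      "\<And>y. T < y \<Longrightarrow> y \<le> b \<Longrightarrow> x / (n * \<sigma>\<^sup>2) * y \<le> q * y powr p"
    and J: "\<And>t. 0 \<le> t \<Longrightarrow> t \<le> 1 \<Longrightarrow> v * J \<le> q * (x * (1 - t)) powr p + v * t\<^sup>2 / (2 * \<sigma>\<^sup>2)"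
    and K: "1 \<le> K"
  shows "prob {\<omega> \<in> space M. x \<le> (\<Sum>i\<in>I. Y i \<omega>)}
    \<le> (real K + 1) * exp (n * exp_tail_moment \<mu> q p T
        - v * (J - 1 / (2 * (real K)\<^sup>2 * \<sigma>\<^sup>2) - square_remainder \<mu> (x / (n * \<sigma>\<^sup>2)) / \<sigma>^4))"
proof -
  have n0: "0 < n" using I n by (simp add: card_gt_0_iff)
  have v0: "0 < v" using n0 assms by simp
  define l where "l = (\<lambda>j. real j / (real K * \<sigma>\<^sup>2))"
  define \<theta> where "\<theta> = (\<lambda>j. l j * v / x)"
  define s where "s = (\<lambda>j. v * (J - 1 / (2 * (real K)\<^sup>2 * \<sigma>\<^sup>2)) + v * (l j)\<^sup>2 * \<sigma>\<^sup>2 / 2)"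
  define E where "E = exp_tail_moment \<mu> q p T"
  define R where "R = square_remainder \<mu> (x / (n * \<sigma>\<^sup>2))"
  have rv: "random_variable borel (Y i)" if "i \<in> I" for i
    using I(3) that by (auto simp: indep_vars_def)
  let ?F = "\<lambda>j. {\<omega> \<in> space M. exp (s j) \<le> (\<Prod>i\<in>I. exp (tilt (\<theta> j) b q p (Y i \<omega>)))}"
  have meas: "?F j \<in> events" for j
    using rv by measurable
  have "{\<omega> \<in> space M. x \<le> (\<Sum>i\<in>I. Y i \<omega>)} \<subseteq> (\<Union>j\<le>K. ?F j)"
  proof
    fix \<omega> assume w: "\<omega> \<in> {\<omega> \<in> space M. x \<le> (\<Sum>i\<in>I. Y i \<omega>)}"
    have "0 < b" using T by simp
    then obtain j where j: "j \<le> K" "s j \<le> (\<Sum>i\<in>I. tilt (\<theta> j) b q p (Y i \<omega>))"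
      using sum_tilt_ge[of I x v b p q \<sigma> K "\<lambda>i. Y i \<omega>" J] I(1) \<open>0 < x\<close> v0 assms(2,6-8) K J w
      unfolding s_def \<theta>_def l_def by blast
    then have "\<omega> \<in> ?F j" using w I(1) by (simp add: exp_sum[symmetric])
    then show "\<omega> \<in> (\<Union>j\<le>K. ?F j)" using j(1) by blast
  qed
  then have "prob {\<omega> \<in> space M. x \<le> (\<Sum>i\<in>I. Y i \<omega>)} \<le> prob (\<Union>j\<le>K. ?F j)"
    using meas by (intro finite_measure_mono) auto
  also have "\<dots> \<le> (\<Sum>j\<le>K. prob (?F j))"
    using meas by (intro finite_measure_subadditive_finite) auto
  also have "\<dots> \<le> (\<Sum>j\<le>K. exp (n * E - v * (J - 1 / (2 * (real K)\<^sup>2 * \<sigma>\<^sup>2) - R / \<sigma>^4)))"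
  proof (rule sum_mono)
    fix j assume "j \<in> {..K}"
    then have jK: "real j / real K \<le> 1" using K by simp
    have l: "0 \<le> l j" "l j \<le> 1 / \<sigma>\<^sup>2"
      using jK assms(2) K by (simp_all add: l_def field_simps)
    have \<theta>_eq: "\<theta> j = l j * x / n"
      using \<open>0 < x\<close> n0 by (simp add: \<theta>_def v power2_eq_square)
    have "\<theta> j \<le> 1 / \<sigma>\<^sup>2 * x / n"
      unfolding \<theta>_eq using l \<open>0 < x\<close> n0 by (intro divide_right_mono mult_right_mono) auto
    \<comment> \<open>The largest slope, at \<open>j = K\<close>, is
      \<open>x / (n * \<sigma>\<^sup>2)\<close>; the conditions on \<open>T\<close> and
      \<open>b\<close> are imposed for it and carry over to all smaller slopes.\<close>
    then have \<theta>: "0 \<le> \<theta> j" "\<theta> j \<le> x / (n * \<sigma>\<^sup>2)"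
      using l \<open>0 < x\<close> n0 by (simp_all add: \<theta>_eq mult.commute)
    have t1: "\<theta> j * T \<le> 1"
      using mult_right_mono[OF \<theta>(2), of T] T by simp
    have t2: "\<theta> j * y \<le> q * y powr p" if "T < y" "y \<le> b" for y
      using mult_right_mono[OF \<theta>(2), of y] T(4)[OF that] T(1) that by simp
    have "prob (?F j) \<le> exp (real (card I) * ((\<theta> j)\<^sup>2 * (\<sigma>\<^sup>2 / 2 + square_remainder \<mu> (\<theta> j)) + E) - s j)"
      unfolding E_def
      by (rule chernoff_iid[OF I(1,3,4) _ _ exp_tilt_moment(1)[OF assms(1,3-5,9) \<theta>(1) T(1,2) t1 t2]
            exp_tilt_moment(2)[OF assms(1,3-5,9) \<theta>(1) T(1,2) t1 t2]]) auto
    also have "real (card I) * ((\<theta> j)\<^sup>2 * (\<sigma>\<^sup>2 / 2 + square_remainder \<mu> (\<theta> j)) + E) - s j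
       = v * (l j)\<^sup>2 * square_remainder \<mu> (\<theta> j) + n * E - v * (J - 1 / (2 * (real K)\<^sup>2 * \<sigma>\<^sup>2))"
    proof -
      \<comment> \<open>Hence the Gaussian part of \<open>n\<close> times the moment bound is
        \<open>v * (l j)\<^sup>2 * \<sigma>\<^sup>2 / 2\<close>, the very term contained in
        \<open>s j\<close>.\<close>
      have *: "n * (\<theta> j)\<^sup>2 = v * (l j)\<^sup>2"
        using n0 by (simp add: \<theta>_eq v power2_eq_square)
      have "n * ((\<theta> j)\<^sup>2 * (\<sigma>\<^sup>2 / 2 + square_remainder \<mu> (\<theta> j)) + E)
          = (n * (\<theta> j)\<^sup>2) * (\<sigma>\<^sup>2 / 2 + square_remainder \<mu> (\<theta> j)) + n * E"
        by (simp add: algebra_simps)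
      then show ?thesis unfolding * n[symmetric] s_def by (simp add: algebra_simps)
    qed
    also have "exp \<dots> \<le> exp (n * E - v * (J - 1 / (2 * (real K)\<^sup>2 * \<sigma>\<^sup>2) - R / \<sigma>^4))"
    proof -
      have "(l j)\<^sup>2 \<le> (1 / \<sigma>\<^sup>2)\<^sup>2" using l by (intro power_mono) auto
      moreover have "square_remainder \<mu> (\<theta> j) \<le> R"
        unfolding R_def by (rule square_remainder_mono[OF assms(1,3) \<theta>])
      moreover have "0 \<le> square_remainder \<mu> (\<theta> j)"
        unfolding square_remainder_def by (intro Bochner_Integration.integral_nonneg) auto
      ultimately have "(l j)\<^sup>2 * square_remainder \<mu> (\<theta> j) \<le> (1 / \<sigma>\<^sup>2)\<^sup>2 * R"
        by (intro mult_mono) auto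
      also have "\<dots> = R / \<sigma>^4" by (simp add: power_divide flip: power_mult)
      finally have "v * ((l j)\<^sup>2 * square_remainder \<mu> (\<theta> j)) \<le> v * (R / \<sigma>^4)"
        using v0 by (intro mult_left_mono) auto
      then show ?thesis by (simp add: algebra_simps)
    qed
    finally show "prob (?F j) \<le> exp (n * E - v * (J - 1 / (2 * (real K)\<^sup>2 * \<sigma>\<^sup>2) - R / \<sigma>^4))" .
  qed
  also have "\<dots> = (real K + 1) * exp (n * E - v * (J - 1 / (2 * (real K)\<^sup>2 * \<sigma>\<^sup>2) - R / \<sigma>^4))"
    by simp
  finally show ?thesis by (simp add: E_def R_def)
qed

section \<open>Tail bounds from the logarithmic asymptotics, and growth of the scaling
  sequences\<close>

lemma log_tail_asymp_bounds:
  fixes F :: "real \<Rightarrow> real"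
  assumes "(\<lambda>y. ln (F y)) \<sim>[at_top] (\<lambda>y. - q * y powr p)" "\<And>y. 0 \<le> F y"
    and "0 \<le> q1" "q1 < q" "q < q2"
  shows "eventually (\<lambda>y. exp (- q2 * y powr p) \<le> F y \<and> F y \<le> exp (- q1 * y powr p)) at_top"
proof -
  let ?r = "\<lambda>y. if ln (F y) = 0 \<and> - q * y powr p = 0 then 1 else ln (F y) / (- q * y powr p)"
  have lim: "(?r \<longlongrightarrow> 1) at_top"
    using assms(1) unfolding asymp_equiv_def .
  have "eventually (\<lambda>y. q1 / q < ?r y) at_top"
    by (rule order_tendstoD(1)[OF lim]) (use assms(3-5) in simp)
  moreover have "eventually (\<lambda>y. ?r y < q2 / q) at_top"
    by (rule order_tendstoD(2)[OF lim]) (use assms(3-5) in simp)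
  ultimately show ?thesis using eventually_gt_at_top[of 0]
  proof eventually_elim
    case (elim y)
    define w where "w = y powr p"
    have w: "0 < w" using elim by (simp add: w_def)
    have q: "0 < q * w" using w assms(3,4) by simp
    have r: "?r y = - ln (F y) / (q * w)" using q by (auto simp: w_def)
    have "q1 / q * (q * w) < - ln (F y)"
      using elim(1) unfolding r pos_less_divide_eq[OF q] .
    then have up: "ln (F y) < - q1 * w" using assms(3,4) by simp
    have "- ln (F y) < q2 / q * (q * w)"
      using elim(2) unfolding r pos_divide_less_eq[OF q] .
    then have low: "- q2 * w < ln (F y)" using assms(3,4) by simp
    \<comment> \<open>By the convention \<open>ln 0 = 0\<close>, a vanishing \<open>F y\<close> is
      excluded, because \<open>ln (F y)\<close> is strictly negative. Only then can the bounds on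
      the logarithm be exponentiated.\<close>
    have "0 \<le> q1 * w" using w assms(3) by simp
    then have "F y \<noteq> 0" using up by auto
    then have "0 < F y" using assms(2)[of y] by simp
    then have "F y = exp (ln (F y))" by simp
    then show ?case
      using up low unfolding w_def[symmetric] by (metis exp_le_cancel_iff less_imp_le)
  qed
qed

lemma scaling_facts:
  fixes x :: "nat \<Rightarrow> real"
  assumes "0 < \<epsilon>" "\<epsilon> < 1" "0 < C" and x: "\<forall>n\<ge>1. x n = C * real n powr (1 / (1 + \<epsilon>))"
  shows "\<And>n. n \<ge> 1 \<Longrightarrow> 0 < x n"
    and "\<And>n. n \<ge> 1 \<Longrightarrow> x n powr (1 + \<epsilon>) = C powr (1 + \<epsilon>) * real n"
    and "\<And>n. n \<ge> 1 \<Longrightarrow> x n powr (1 - \<epsilon>) = (x n)\<^sup>2 / real n / C powr (1 + \<epsilon>)"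
    and "filterlim x at_top sequentially"
    and "filterlim (\<lambda>n. (x n)\<^sup>2 / real n) at_top sequentially"
    and "(\<lambda>n. x n / real n) \<longlonglongrightarrow> 0"
proof -
  show pos: "0 < x n" if "n \<ge> 1" for n
    using that assms by simp
  show a: "x n powr (1 + \<epsilon>) = C powr (1 + \<epsilon>) * real n" if "n \<ge> 1" for n
    using that assms by (simp add: powr_mult powr_powr)
  show "x n powr (1 - \<epsilon>) = (x n)\<^sup>2 / real n / C powr (1 + \<epsilon>)" if "n \<ge> 1" for n
  proof -
    have "x n powr (1 - \<epsilon>) * x n powr (1 + \<epsilon>) = (x n)\<^sup>2"
      using pos[OF that] by (simp flip: powr_add)
    then show ?thesis using that assms(3) unfolding a[OF that] by (simp add: field_simps)
  qed
  let ?x = "\<lambda>n. C * real n powr (1 / (1 + \<epsilon>))"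
  have ev: "eventually (\<lambda>n. n \<ge> 1 \<and> ?x n = x n) sequentially"
    using eventually_ge_at_top[of 1] by eventually_elim (simp add: x)
  \<comment> \<open>The exponent lies strictly between 1/2 and 1: the lower limit makes
    \<open>x\<^sup>2 / n\<close> diverge, the upper one makes \<open>x / n\<close> vanish.\<close>
  define r where "r = 1 / (1 + \<epsilon>)"
  have r: "0 < r" "r < 1" "0 < 2 * r - 1"
    using assms by (auto simp: r_def field_simps)
  have "filterlim ?x at_top sequentially"
    unfolding r_def[symmetric] using r assms(3) by real_asymp
  then show "filterlim x at_top sequentially"
    by (rule filterlim_mono_eventually[OF _ order_refl order_refl]) (use ev in eventually_elim, simp)
  have "filterlim (\<lambda>n. C\<^sup>2 * real n powr (2 * r - 1)) at_top sequentially"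
    using r assms(3) by real_asymp
  then show "filterlim (\<lambda>n. (x n)\<^sup>2 / real n) at_top sequentially"
  proof (rule filterlim_mono_eventually[OF _ order_refl order_refl])
    show "eventually (\<lambda>n. C\<^sup>2 * real n powr (2 * r - 1) = (x n)\<^sup>2 / real n) sequentially"
      using ev
    proof eventually_elim
      case (elim n)
      then have "0 < real n" by simp
      then have "real n powr (2 * r - 1) = (real n powr r)\<^sup>2 / real n"
        using powr_add[of "real n" r r] powr_diff[of "real n" "r + r" 1] by (simp add: power2_eq_square)
      moreover have "x n = C * real n powr r" using elim by (simp add: r_def)
      ultimately show ?case by (simp add: power_mult_distrib)
    qed
  qed
  have "(\<lambda>n. C * real n powr (r - 1)) \<longlonglongrightarrow> 0"
    using r assms(3) by real_asymp
  then show "(\<lambda>n. x n / real n) \<longlonglongrightarrow> 0"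
  proof (rule Lim_transform_eventually)
    show "eventually (\<lambda>n. C * real n powr (r - 1) = x n / real n) sequentially"
      using ev by eventually_elim (auto simp: r_def[symmetric] powr_diff)
  qed
qed

section \<open>Asymptotic lower and upper bounds for the tail of the sum\<close>

text \<open>For a fixed split \<open>t\<close>, the first summand supplies
  \<open>(1 - t) * x n\<close> and the other \<open>n - 1\<close> supply \<open>t * x n\<close>. The
  error \<eta> is divided equally between the two factors.\<close>

lemma iid_tail_lower:
  assumes \<mu>: "real_distribution \<mu>" "0 < \<sigma>" "integrable \<mu> (\<lambda>y. y\<^sup>2)"
    "(\<integral>y. y \<partial>\<mu>) = 0" "(\<integral>y. y\<^sup>2 \<partial>\<mu>) = \<sigma>\<^sup>2"
    and e: "0 < \<epsilon>" "\<epsilon> < 1" "0 < C" and x: "\<forall>n\<ge>1. x n = C * real n powr (1 / (1 + \<epsilon>))"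
    and tail: "\<And>q'. q < q' \<Longrightarrow> eventually (\<lambda>y. exp (- q' * y powr (1 - \<epsilon>)) \<le> measure \<mu> {y..}) at_top"
    and t: "0 \<le> t" "t \<le> 1" and \<eta>: "0 < \<eta>"
  shows "eventually (\<lambda>n. exp (- ((x n)\<^sup>2 / real n * (q * (1 - t) powr (1 - \<epsilon>) / C powr (1 + \<epsilon>) + t\<^sup>2 / (2 * \<sigma>\<^sup>2) + \<eta>)))
    \<le> measure (conv_power n \<mu>) {x n..}) sequentially"
proof -
  interpret \<mu>: real_distribution \<mu> by fact
  note sc = scaling_facts[OF e x]
  define v where "v = (\<lambda>n. (x n)\<^sup>2 / real n)"
  define h where "h = q * (1 - t) powr (1 - \<epsilon>) / C powr (1 + \<epsilon>)"
  have v_lim: "filterlim v at_top sequentially" unfolding v_def by (rule sc(5))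
  have pos0: "0 < measure \<mu> {0..}"
  proof -
    have "eventually (\<lambda>y. exp (- (q + 1) * y powr (1 - \<epsilon>)) \<le> measure \<mu> {y..} \<and> 0 \<le> y) at_top"
      by (intro eventually_conj tail eventually_ge_at_top) simp
    then obtain y where y: "exp (- (q + 1) * y powr (1 - \<epsilon>)) \<le> measure \<mu> {y..}" "0 \<le> y"
      using eventually_happens'[of "at_top :: real filter"] by auto
    have "0 < exp (- (q + 1) * y powr (1 - \<epsilon>))" by simp
    also note y(1)
    also have "measure \<mu> {y..} \<le> measure \<mu> {0..}"
      using y(2) by (intro \<mu>.finite_measure_mono) auto
    finally show ?thesis .
  qed
  have one: "eventually (\<lambda>n. exp (- (v n * (h + \<eta> / 2))) \<le> measure \<mu> {(1 - t) * x n..}) sequentially"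
  proof (cases "t = 1")
    \<comment> \<open>At \<open>t = 1\<close> the required level is 0 for every \<open>n\<close>, so
      the tail asymptotics say nothing; the probability is a positive constant, absorbed because
      \<open>v\<close> diverges.\<close>
    case True
    define c where "c = measure \<mu> {0..}"
    have "eventually (\<lambda>n. - ln c / (\<eta> / 2) \<le> v n) sequentially"
      using v_lim by (auto simp: filterlim_at_top)
    then show ?thesis
    proof eventually_elim
      case (elim n)
      have "- ln c \<le> v n * (\<eta> / 2)"
        using elim \<eta> pos_divide_le_eq[of "\<eta> / 2" "- ln c" "v n"] by simp
      then have "exp (- (v n * (\<eta> / 2))) \<le> c"
        using pos0 ln_ge_iff[of c "- (v n * (\<eta> / 2))"] unfolding c_def by linarith
      then show ?case using True by (simp add: h_def c_def)
    qed
  next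
    case False
    then have t1: "0 < 1 - t" using t by simp
    \<comment> \<open>The excess over \<open>q\<close> is chosen so that, after division by
      \<open>C powr (1 + \<epsilon>)\<close>, it adds at most \<open>\<eta> / 2\<close> to the
      cost.\<close>
    define q' where "q' = q + C powr (1 + \<epsilon>) * (\<eta> / 2)"
    have "q < q'" using e \<eta> by (simp add: q'_def)
    have "filterlim (\<lambda>n. (1 - t) * x n) at_top sequentially"
      using sc(4) t1 by (intro filterlim_tendsto_pos_mult_at_top[OF tendsto_const]) auto
    with tail[OF \<open>q < q'\<close>] have "eventually (\<lambda>n. exp (- q' * ((1 - t) * x n) powr (1 - \<epsilon>))
        \<le> measure \<mu> {(1 - t) * x n..}) sequentially"
      by (rule eventually_compose_filterlim)
    then show ?thesis using eventually_ge_at_top[of 1]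
    proof eventually_elim
      case (elim n)
      define a where "a = (1 - t) powr (1 - \<epsilon>)"
      have a: "0 \<le> a" "a \<le> 1"
        using t e by (auto simp: a_def intro!: powr_le1)
      have v0: "0 \<le> v n" by (simp add: v_def)
      have "q' * ((1 - t) * x n) powr (1 - \<epsilon>) = q' * (a * (v n / C powr (1 + \<epsilon>)))"
        using sc(1)[OF elim(2)] sc(3)[OF elim(2)] t1 by (simp add: powr_mult a_def v_def)
      also have "\<dots> = v n * (h + a * (\<eta> / 2))"
        using e(3) by (simp add: q'_def h_def a_def[symmetric] field_simps)
      also have "\<dots> \<le> v n * (h + 1 * (\<eta> / 2))"
        using v0 a \<eta> by (intro mult_left_mono add_left_mono mult_right_mono) auto
      finally have "exp (- (v n * (h + \<eta> / 2))) \<le> exp (- q' * ((1 - t) * x n) powr (1 - \<epsilon>))"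
        by simp
      then show ?case using elim(1) by (rule order_trans)
    qed
  qed
  have "eventually (\<lambda>n. exp (- (v n * (t\<^sup>2 / (2 * \<sigma>\<^sup>2) + \<eta> / 2))) \<le> measure (conv_power (n - 1) \<mu>) {t * x n..}) sequentially"
    unfolding v_def using \<eta> by (intro moderate_deviation_lower \<mu> pos0 sc t) auto
  with one show ?thesis using eventually_ge_at_top[of 1]
  proof eventually_elim
    case (elim n)
    have "exp (- (v n * (h + t\<^sup>2 / (2 * \<sigma>\<^sup>2) + \<eta>)))
        = exp (- (v n * (h + \<eta> / 2))) * exp (- (v n * (t\<^sup>2 / (2 * \<sigma>\<^sup>2) + \<eta> / 2)))"
      unfolding exp_add[symmetric] by (rule arg_cong[where f = exp]) (simp add: algebra_simps)
    also have "\<dots> \<le> measure \<mu> {(1 - t) * x n..} * measure (conv_power (n - 1) \<mu>) {t * x n..}"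
      using elim by (intro mult_mono) auto
    also have "\<dots> \<le> measure (\<mu> \<star> conv_power (n - 1) \<mu>) {(1 - t) * x n + t * x n..}"
      by (intro convolution_atLeast_ge real_distribution_conv_power \<mu>)
    also have "(\<mu> \<star> conv_power (n - 1) \<mu>) = conv_power (Suc (n - 1)) \<mu>" by simp
    also have "Suc (n - 1) = n" using elim by simp
    also have "(1 - t) * x n + t * x n = x n" by (simp add: algebra_simps)
    finally show ?case by (simp add: v_def h_def)
  qed
qed

text \<open>\<open>iid_sum_tail_le\<close> is applied with parameters depending on \<open>n\<close>.
  Five errors of at most \<open>\<eta> / 6\<close> each occur in units of \<open>v n\<close>:
  reducing the rate \<open>q\<close>, the slope grid, the square remainder, the exponential tail
  moment, and the factor \<open>K + 1\<close>.\<close>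

lemma iid_tail_upper:
  assumes \<mu>: "real_distribution \<mu>" "0 < \<sigma>" "integrable \<mu> (\<lambda>y. y\<^sup>2)"
    "(\<integral>y. y \<partial>\<mu>) = 0" "(\<integral>y. y\<^sup>2 \<partial>\<mu>) = \<sigma>\<^sup>2"
    and e: "0 < \<epsilon>" "\<epsilon> < 1" "0 < C" and x: "\<forall>n\<ge>1. x n = C * real n powr (1 / (1 + \<epsilon>))"
    and "0 < q"
    and tail: "\<And>q'. 0 \<le> q' \<Longrightarrow> q' < q \<Longrightarrow> eventually (\<lambda>y. measure \<mu> {y..} \<le> exp (- q' * y powr (1 - \<epsilon>))) at_top"
    and M: "\<And>n. n \<ge> 1 \<Longrightarrow> prob_space (M n)"
    and ind: "\<And>n. n \<ge> 1 \<Longrightarrow> prob_space.indep_vars (M n) (\<lambda>_. borel) (Y n) {1..n}"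
    and distr: "\<And>n i. n \<ge> 1 \<Longrightarrow> i \<in> {1..n} \<Longrightarrow> distr (M n) borel (Y n i) = \<mu>"
    and I: "0 \<le> I" "\<And>t. 0 \<le> t \<Longrightarrow> t \<le> 1 \<Longrightarrow>
      I \<le> q * (1 - t) powr (1 - \<epsilon>) / C powr (1 + \<epsilon>) + t\<^sup>2 / (2 * \<sigma>\<^sup>2)"
    and \<eta>: "0 < \<eta>"
  shows "eventually (\<lambda>n. measure (M n) {\<omega> \<in> space (M n). x n \<le> (\<Sum>i=1..n. Y n i \<omega>)}
    \<le> exp (- ((x n)\<^sup>2 / real n * (I - \<eta>)))) sequentially"
proof -
  note sc = scaling_facts[OF e x]
  define p where "p = 1 - \<epsilon>"
  have p: "0 < p" "p \<le> 1" using e by (simp_all add: p_def)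
  define v where "v = (\<lambda>n. (x n)\<^sup>2 / real n)"
  have v_lim: "filterlim v at_top sequentially" unfolding v_def by (rule sc(5))
  \<comment> \<open>Relative loss in the rate; the denominator \<open>I + 1\<close> stays positive
    when \<open>I = 0\<close> and still gives \<open>\<kappa> * I \<le> \<eta> / 6\<close>.\<close>
  define \<kappa> where "\<kappa> = min (1 / 2) (\<eta> / (6 * (I + 1)))"
  have \<kappa>: "0 < \<kappa>" "\<kappa> < 1" "\<kappa> * I \<le> \<eta> / 6"
  proof -
    show "0 < \<kappa>" "\<kappa> < 1" using I \<eta> by (simp_all add: \<kappa>_def)
    have "\<kappa> * I \<le> \<eta> / (6 * (I + 1)) * I"
      using I by (intro mult_right_mono) (auto simp: \<kappa>_def)
    also have "\<dots> = \<eta> / 6 * (I / (I + 1))" by simp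
    also have "\<dots> \<le> \<eta> / 6 * 1" using I \<eta> by (intro mult_left_mono) auto
    finally show "\<kappa> * I \<le> \<eta> / 6" by simp
  qed
  \<comment> \<open>Three rates below \<open>q\<close>: the tail is bounded with \<open>q4\<close>,
    which makes the exponential moment with \<open>q3\<close> finite, and the gap between
    \<open>q3\<close> and the rate \<open>q2\<close> used in \<open>tilt\<close> gives decay of the
    tail moment.\<close>
  define q2 where "q2 = (1 - \<kappa>) * q"
  define q3 where "q3 = (1 - \<kappa> / 2) * q"
  define q4 where "q4 = (1 - \<kappa> / 4) * q"
  have q: "0 < q2" "q2 < q3" "q3 < q4" "q4 < q"
    using \<kappa> \<open>0 < q\<close> by (simp_all add: q2_def q3_def q4_def algebra_simps)
  have tail4: "eventually (\<lambda>y. measure \<mu> {y..} \<le> exp (- q4 * y powr p)) at_top"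
    unfolding p_def using q by (intro tail) auto
  have int3: "integrable \<mu> (\<lambda>y. exp (q3 * y powr p) * indicator {0<..} y)"
    by (rule integrable_exp_powr[OF \<mu>(1) p(1) _ q(3) tail4]) (use q in simp)
  have int2: "integrable \<mu> (\<lambda>y. exp (q2 * y powr p) * indicator {0<..} y)"
    by (rule integrable_exp_powr[OF \<mu>(1) p(1) _ _ tail4]) (use q in simp_all)
  define J where "J = (1 - \<kappa>) * I"
  \<comment> \<open>Chosen so that at \<open>y = \<delta> * x n\<close> the line with the largest
    slope \<open>x n / (n * \<sigma>\<^sup>2)\<close> meets \<open>q2 * y powr p\<close>; to the
    left of this point the line stays below the concave function.\<close>
  define \<delta> where "\<delta> = (q2 * \<sigma>\<^sup>2 / C powr (1 + \<epsilon>)) powr (1 / \<epsilon>)"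
  have \<delta>: "0 < \<delta>" "\<delta> powr \<epsilon> = q2 * \<sigma>\<^sup>2 / C powr (1 + \<epsilon>)"
    using q \<mu>(2) e by (simp_all add: \<delta>_def powr_powr)
  \<comment> \<open>The reciprocal of the largest slope, hence the largest admissible end of the
    range of the quadratic expansion.\<close>
  define T where "T = (\<lambda>n. real n * \<sigma>\<^sup>2 / x n)"
  define K where "K = nat \<lceil>sqrt (3 / (\<eta> * \<sigma>\<^sup>2))\<rceil> + 1"
  have K: "1 \<le> K" "1 / (2 * (real K)\<^sup>2 * \<sigma>\<^sup>2) \<le> \<eta> / 6"
  proof -
    show "1 \<le> K" by (simp add: K_def)
    have "sqrt (3 / (\<eta> * \<sigma>\<^sup>2)) \<le> real K" unfolding K_def by linarith
    then have "3 / (\<eta> * \<sigma>\<^sup>2) \<le> (real K)\<^sup>2"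
      by (rule sqrt_le_D)
    then have "3 \<le> (real K)\<^sup>2 * (\<eta> * \<sigma>\<^sup>2)"
      using \<eta> \<mu>(2) by (simp add: pos_divide_le_eq)
    moreover have "0 < 2 * (real K)\<^sup>2 * \<sigma>\<^sup>2" using \<open>1 \<le> K\<close> \<mu>(2) by simp
    ultimately show "1 / (2 * (real K)\<^sup>2 * \<sigma>\<^sup>2) \<le> \<eta> / 6"
      by (simp add: pos_divide_le_eq mult_ac)
  qed
  \<comment> \<open>Equivalent to \<open>T n \<le> \<delta> * x n\<close>.\<close>
  have e1: "eventually (\<lambda>n. \<sigma>\<^sup>2 / \<delta> \<le> v n) sequentially"
    using v_lim by (auto simp: filterlim_at_top)
  have e2: "eventually (\<lambda>n. ln (real K + 1) / (\<eta> / 6) \<le> v n) sequentially"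
    using v_lim by (auto simp: filterlim_at_top)
  have "(\<lambda>n. x n / real n * inverse (\<sigma>\<^sup>2)) \<longlonglongrightarrow> 0 * inverse (\<sigma>\<^sup>2)"
    by (intro tendsto_intros sc(6))
  then have "(\<lambda>n. x n / (real n * \<sigma>\<^sup>2)) \<longlonglongrightarrow> 0"
    by (simp add: divide_inverse mult.assoc)
  then have R_lim: "(\<lambda>n. square_remainder \<mu> (x n / (real n * \<sigma>\<^sup>2))) \<longlonglongrightarrow> 0"
    by (rule square_remainder_tendsto_zero[OF \<mu>(1,3)])
  have e3: "eventually (\<lambda>n. square_remainder \<mu> (x n / (real n * \<sigma>\<^sup>2)) < \<eta> / 6 * \<sigma>^4) sequentially"
    by (rule order_tendstoD(2)[OF R_lim]) (use \<eta> \<mu>(2) in simp)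
  define H where "H = (\<integral>y. exp (q3 * y powr p) * indicator {0<..} y \<partial>\<mu>)"
  \<comment> \<open>\<open>T n\<close> grows like a positive power of \<open>n\<close>, so the
    stretched exponential beats the factor \<open>n\<close>.\<close>
  have T_lim: "(\<lambda>n. real n * (exp (- (q3 - q2) * T n powr p) * H)) \<longlonglongrightarrow> 0"
  proof -
    define a b r where "a = q3 - q2" and "b = \<sigma>\<^sup>2 / C" and "r = 1 - 1 / (1 + \<epsilon>)"
    have abr: "0 < a" "0 < b" "0 < r"
      using q e \<mu>(2) by (auto simp: a_def b_def r_def field_simps)
    have "(\<lambda>n. real n * exp (- a * (b * real n powr r) powr p)) \<longlonglongrightarrow> 0"
      using abr p by real_asymp
    then have "(\<lambda>n. real n * exp (- a * (b * real n powr r) powr p) * H) \<longlonglongrightarrow> 0"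
      by (rule tendsto_mult_left_zero)
    then show ?thesis
    proof (rule Lim_transform_eventually)
      show "eventually (\<lambda>n. real n * exp (- a * (b * real n powr r) powr p) * H
          = real n * (exp (- (q3 - q2) * T n powr p) * H)) sequentially"
        using eventually_ge_at_top[of 1]
      proof eventually_elim
        case (elim n)
        then have "T n = b * real n powr r"
          using x by (simp add: T_def b_def r_def powr_diff)
        then show ?case by (simp add: a_def)
      qed
    qed
  qed
  have e4: "eventually (\<lambda>n. real n * (exp (- (q3 - q2) * T n powr p) * H) < \<eta> / 6) sequentially"
    by (rule order_tendstoD(2)[OF T_lim]) (use \<eta> in simp)
  have e5: "eventually (\<lambda>n. 1 \<le> v n) sequentially"
    using v_lim by (auto simp: filterlim_at_top)
  from e1 e2 e3 e4 e5 eventually_ge_at_top[of 1] show ?thesis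
  proof eventually_elim
    case (elim n)
    interpret prob_space "M n" by (rule M[OF elim(6)])
    have n: "0 < real n" using elim(6) by simp
    have xn: "0 < x n" by (rule sc(1)[OF elim(6)])
    have vn: "0 < v n" using elim(5) by simp
    have T0: "0 < T n" using n xn \<mu>(2) by (simp add: T_def)
    have Tb: "T n \<le> \<delta> * x n"
    proof -
      have "\<sigma>\<^sup>2 \<le> v n * \<delta>" using elim(1) \<delta>(1) by (simp add: pos_divide_le_eq)
      then have "real n * \<sigma>\<^sup>2 \<le> real n * (v n * \<delta>)" using n by (intro mult_left_mono) auto
      also have "\<dots> = \<delta> * x n * x n" using n by (simp add: v_def power2_eq_square)
      finally show ?thesis using xn by (simp add: T_def pos_divide_le_eq)
    qed
    have TT: "x n / (real n * \<sigma>\<^sup>2) * T n \<le> 1"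
      using n xn \<mu>(2) by (simp add: T_def)
    have lin: "x n / (real n * \<sigma>\<^sup>2) * y \<le> q2 * y powr p" if "T n < y" "y \<le> \<delta> * x n" for y
    proof -
      have y: "0 < y" using that T0 by simp
      have "x n * x n powr \<epsilon> = x n powr (1 + \<epsilon>)" using xn by (simp add: powr_add)
      then have xe: "x n * x n powr \<epsilon> = C powr (1 + \<epsilon>) * real n"
        using sc(2)[OF elim(6)] by simp
      have "x n * y powr \<epsilon> \<le> x n * (\<delta> * x n) powr \<epsilon>"
        using y that xn e by (intro mult_left_mono powr_mono2) auto
      also have "\<dots> = \<delta> powr \<epsilon> * (x n * x n powr \<epsilon>)"
        using xn \<delta>(1) by (simp add: powr_mult)
      also have "\<dots> = q2 * (real n * \<sigma>\<^sup>2)"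
        unfolding xe \<delta>(2) using e(3) by simp
      finally have "x n * y powr \<epsilon> / (real n * \<sigma>\<^sup>2) \<le> q2"
        using n \<mu>(2) by (simp add: pos_divide_le_eq)
      then have "x n * y powr \<epsilon> / (real n * \<sigma>\<^sup>2) * y powr p \<le> q2 * y powr p"
        by (rule mult_right_mono) simp
      moreover have "y powr \<epsilon> * y powr p = y"
        using y by (simp add: p_def flip: powr_add)
      ultimately show ?thesis by (simp add: mult_ac)
    qed
    have xp: "x n powr p = v n / C powr (1 + \<epsilon>)"
      using sc(3)[OF elim(6)] by (simp only: p_def v_def)
    have J: "v n * J \<le> q2 * (x n * (1 - t)) powr p + v n * t\<^sup>2 / (2 * \<sigma>\<^sup>2)" if t: "0 \<le> t" "t \<le> 1" for t
    proof -
      have "J \<le> (1 - \<kappa>) * (q * (1 - t) powr p / C powr (1 + \<epsilon>) + t\<^sup>2 / (2 * \<sigma>\<^sup>2))"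
        unfolding J_def p_def using I(2)[OF t] \<kappa> by (intro mult_left_mono) auto
      \<comment> \<open>Only the jump cost has to shrink by the factor \<open>1 - \<kappa>\<close>;
        the quadratic cost may be restored to full size since this only enlarges the right
        side.\<close>
      also have "\<dots> \<le> q2 * (1 - t) powr p / C powr (1 + \<epsilon>) + t\<^sup>2 / (2 * \<sigma>\<^sup>2)"
        using \<kappa> mult_right_mono[of "1 - \<kappa>" 1 "t\<^sup>2 / (2 * \<sigma>\<^sup>2)"] by (simp add: q2_def distrib_left)
      finally have "v n * J \<le> v n * (q2 * (1 - t) powr p / C powr (1 + \<epsilon>) + t\<^sup>2 / (2 * \<sigma>\<^sup>2))"
        using vn by (intro mult_left_mono) auto
      also have "\<dots> = q2 * (x n powr p * (1 - t) powr p) + v n * t\<^sup>2 / (2 * \<sigma>\<^sup>2)"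
        unfolding xp by (simp add: distrib_left)
      also have "x n powr p * (1 - t) powr p = (x n * (1 - t)) powr p"
        using xn t by (simp add: powr_mult)
      finally show ?thesis .
    qed
    define E where "E = exp_tail_moment \<mu> q2 p (T n)"
    define R where "R = square_remainder \<mu> (x n / (real n * \<sigma>\<^sup>2))"
    have "prob {\<omega> \<in> space (M n). x n \<le> (\<Sum>i=1..n. Y n i \<omega>)}
      \<le> (real K + 1) * exp (real n * E - v n * (J - 1 / (2 * (real K)\<^sup>2 * \<sigma>\<^sup>2) - R / \<sigma>^4))"
      unfolding E_def R_def
    proof (rule iid_sum_tail_le[OF \<mu> p q(1) int2 _ _ ind[OF elim(6)] _ _ xn _ T0 Tb TT])
      show "x n / (real n * \<sigma>\<^sup>2) * y \<le> q2 * y powr p" if "T n < y" "y \<le> \<delta> * x n" for y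
        by (rule lin[OF that])
      show "v n * J \<le> q2 * (x n * (1 - t)) powr p + v n * t\<^sup>2 / (2 * \<sigma>\<^sup>2)" if "0 \<le> t" "t \<le> 1" for t
        by (rule J[OF that])
      show "distr (M n) borel (Y n i) = \<mu>" if "i \<in> {1..n}" for i
        by (rule distr[OF elim(6) that])
    qed (use elim(6) K(1) in \<open>simp_all add: v_def\<close>)
    also have "\<dots> \<le> exp (v n * (\<eta> / 6)) * exp (v n * (\<eta> / 6) - v n * (I - \<eta> / 6 - \<eta> / 6 - \<eta> / 6))"
    proof (rule mult_mono)
      have "ln (real K + 1) \<le> v n * (\<eta> / 6)"
        using elim(2) \<eta> pos_divide_le_eq[of "\<eta> / 6" "ln (real K + 1)" "v n"] by simp
      then have "exp (ln (real K + 1)) \<le> exp (v n * (\<eta> / 6))" by (subst exp_le_cancel_iff)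
      then show "real K + 1 \<le> exp (v n * (\<eta> / 6))" by simp
      have "E \<le> exp (- (q3 - q2) * T n powr p) * H"
        unfolding E_def H_def using q T0 by (intro exp_tail_moment_le \<mu> int3 p) auto
      then have "real n * E \<le> real n * (exp (- (q3 - q2) * T n powr p) * H)"
        using n by (intro mult_left_mono) auto
      also have "\<dots> \<le> 1 * (\<eta> / 6)" using elim(4) by simp
      also have "\<dots> \<le> v n * (\<eta> / 6)" using elim(5) \<eta> by (intro mult_right_mono) auto
      finally have nE: "real n * E \<le> v n * (\<eta> / 6)" .
      have "R / \<sigma>^4 \<le> \<eta> / 6"
        using elim(3) \<mu>(2) pos_divide_le_eq[of "\<sigma>^4" R "\<eta> / 6"] by (simp add: R_def)
      moreover have "I - \<eta> / 6 \<le> J" using \<kappa>(3) by (simp add: J_def algebra_simps)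
      ultimately have "I - \<eta> / 6 - \<eta> / 6 - \<eta> / 6 \<le> J - 1 / (2 * (real K)\<^sup>2 * \<sigma>\<^sup>2) - R / \<sigma>^4"
        using K(2) by linarith
      then have "v n * (I - \<eta> / 6 - \<eta> / 6 - \<eta> / 6) \<le> v n * (J - 1 / (2 * (real K)\<^sup>2 * \<sigma>\<^sup>2) - R / \<sigma>^4)"
        using vn by (intro mult_left_mono) auto
      then show "exp (real n * E - v n * (J - 1 / (2 * (real K)\<^sup>2 * \<sigma>\<^sup>2) - R / \<sigma>^4))
          \<le> exp (v n * (\<eta> / 6) - v n * (I - \<eta> / 6 - \<eta> / 6 - \<eta> / 6))"
        using nE by (subst exp_le_cancel_iff) linarith
    qed auto
    also have "\<dots> = exp (- (v n * (I - 5 * \<eta> / 6)))"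
      unfolding exp_add[symmetric] by (rule arg_cong[where f = exp]) (simp add: algebra_simps)
    also have "\<dots> \<le> exp (- (v n * (I - \<eta>)))"
      using vn \<eta> by simp
    finally show ?case by (simp add: v_def)
  qed
qed

section \<open>The limit, by transfer to the common law and comparison of the two bounds\<close>

theorem theorem3:
  fixes \<epsilon> q \<gamma> \<sigma> C :: real
    and N :: "'a measure" and X :: "'a \<Rightarrow> real"
    and M :: "nat \<Rightarrow> 'b measure" and Y :: "nat \<Rightarrow> nat \<Rightarrow> 'b \<Rightarrow> real"
    and x :: "nat \<Rightarrow> real"
  assumes "0 < \<epsilon>" "\<epsilon> < 1" "0 < q"
    and "prob_space N" "X \<in> borel_measurable N"
    and "(\<lambda>y::real. ln (\<P>(\<omega> in N. X \<omega> \<ge> y))) \<sim>[at_top] (\<lambda>y. - q * y powr (1 - \<epsilon>))"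
    and "0 < \<gamma>" "integrable N (\<lambda>\<omega>. \<bar>X \<omega>\<bar> powr (2 + \<gamma>))"
    and "prob_space.expectation N X = 0"
    and "0 < \<sigma>" "\<sigma>\<^sup>2 = prob_space.variance N X"
    and "\<And>n. n \<ge> 1 \<Longrightarrow> prob_space (M n)"
    and "\<And>n. n \<ge> 1 \<Longrightarrow> prob_space.indep_vars (M n) (\<lambda>_. borel) (Y n) {1..n}"
    and "\<And>n i. n \<ge> 1 \<Longrightarrow> i \<in> {1..n} \<Longrightarrow> distr (M n) borel (Y n i) = distr N borel X"
    and "0 < C" "\<And>n. n \<ge> 1 \<Longrightarrow> x n = C * real n powr (1 / (1 + \<epsilon>))"
  shows "(\<lambda>n. real n / (x n)\<^sup>2 * ln (\<P>(\<omega> in M n. (\<Sum>i=1..n. Y n i \<omega>) \<ge> x n)))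
    \<longlonglongrightarrow> - (INF t\<in>{0..1}. q * (1 - t) powr (1 - \<epsilon>) / C powr (1 + \<epsilon>) + t\<^sup>2 / (2 * \<sigma>\<^sup>2))"
proof -
  note e = assms(1,2) and q = assms(3)
  interpret N: prob_space N by fact
  note X[measurable] = assms(5)
  define \<mu> where "\<mu> = distr N borel X"
  have \<mu>: "real_distribution \<mu>"
    unfolding \<mu>_def using X by (rule N.real_distribution_distr)
  have sq: "integrable N (\<lambda>\<omega>. (X \<omega>)\<^sup>2)"
  proof (rule Bochner_Integration.integrable_bound[where f = "\<lambda>\<omega>. 1 + \<bar>X \<omega>\<bar> powr (2 + \<gamma>)"])
    show "integrable N (\<lambda>\<omega>. 1 + \<bar>X \<omega>\<bar> powr (2 + \<gamma>))"
      using assms(8) by simp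
    show "AE \<omega> in N. norm ((X \<omega>)\<^sup>2) \<le> norm (1 + \<bar>X \<omega>\<bar> powr (2 + \<gamma>))"
    proof (rule AE_I2)
      fix \<omega>
      have "(X \<omega>)\<^sup>2 \<le> 1 + \<bar>X \<omega>\<bar> powr (2 + \<gamma>)"
      proof (cases "\<bar>X \<omega>\<bar> \<le> 1")
        case True
        then have "(X \<omega>)\<^sup>2 \<le> 1" by (simp add: abs_square_le_1)
        then show ?thesis using powr_ge_zero[of "\<bar>X \<omega>\<bar>" "2 + \<gamma>"] by linarith
      next
        case False
        then have "\<bar>X \<omega>\<bar> powr 2 \<le> \<bar>X \<omega>\<bar> powr (2 + \<gamma>)"
          using assms(7) by (intro powr_mono) auto
        then show ?thesis using False by simp
      qed
      then show "norm ((X \<omega>)\<^sup>2) \<le> norm (1 + \<bar>X \<omega>\<bar> powr (2 + \<gamma>))"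
        by simp
    qed
  qed measurable
  have \<mu>_sq: "integrable \<mu> (\<lambda>y. y\<^sup>2)"
    unfolding \<mu>_def using sq by (subst integrable_distr_eq) auto
  have \<mu>_mean: "(\<integral>y. y \<partial>\<mu>) = 0"
    unfolding \<mu>_def using assms(9) by (subst integral_distr) auto
  have \<mu>_var: "(\<integral>y. y\<^sup>2 \<partial>\<mu>) = \<sigma>\<^sup>2"
    unfolding \<mu>_def using assms(9,11) by (subst integral_distr) auto
  note \<mu>s = \<mu> assms(10) \<mu>_sq \<mu>_mean \<mu>_var
  have tail_eq: "\<P>(\<omega> in N. X \<omega> \<ge> y) = measure \<mu> {y..}" for y
    unfolding \<mu>_def by (subst measure_distr) (auto intro!: arg_cong[where f = "measure N"])
  have tails: "eventually (\<lambda>y. exp (- q2 * y powr (1 - \<epsilon>)) \<le> measure \<mu> {y..}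
      \<and> measure \<mu> {y..} \<le> exp (- q1 * y powr (1 - \<epsilon>))) at_top" if "0 \<le> q1" "q1 < q" "q < q2" for q1 q2
    using assms(6) that unfolding tail_eq by (intro log_tail_asymp_bounds) auto
  have low: "eventually (\<lambda>y. exp (- q' * y powr (1 - \<epsilon>)) \<le> measure \<mu> {y..}) at_top" if "q < q'" for q'
    using tails[of 0 q'] q that by (auto elim: eventually_mono)
  have up: "eventually (\<lambda>y. measure \<mu> {y..} \<le> exp (- q' * y powr (1 - \<epsilon>))) at_top" if "0 \<le> q'" "q' < q" for q'
    using tails[of q' "q + 1"] that by (auto elim: eventually_mono)
  have x: "\<forall>n\<ge>1. x n = C * real n powr (1 / (1 + \<epsilon>))"
    using assms(16) by blast
  note sc = scaling_facts[OF e assms(15) x]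
  define G where "G = (\<lambda>t. q * (1 - t) powr (1 - \<epsilon>) / C powr (1 + \<epsilon>) + t\<^sup>2 / (2 * \<sigma>\<^sup>2))"
  define I where "I = (INF t\<in>{0..1}. G t)"
  have G0: "0 \<le> G t" for t
    using q by (simp add: G_def)
  then have bdd: "bdd_below (G ` {0..1})" by (auto intro!: bdd_belowI[of _ 0])
  have I0: "0 \<le> I" unfolding I_def using G0 by (intro cINF_greatest) auto
  have I_le: "I \<le> G t" if "0 \<le> t" "t \<le> 1" for t
    unfolding I_def using bdd that by (intro cINF_lower) auto
  define P where "P = (\<lambda>n. \<P>(\<omega> in M n. (\<Sum>i=1..n. Y n i \<omega>) \<ge> x n))"
  have P_eq: "P n = measure (conv_power n \<mu>) {x n..}" if "n \<ge> 1" for n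
  proof -
    interpret prob_space "M n" by (rule assms(12)[OF that])
    have "random_variable borel (Y n i)" if "i \<in> {1..n}" for i
      using assms(13)[OF \<open>n \<ge> 1\<close>] that unfolding indep_vars_def by blast
    then have rv: "random_variable borel (\<lambda>\<omega>. \<Sum>i=1..n. Y n i \<omega>)"
      by (rule borel_measurable_sum)
    have "distr (M n) borel (\<lambda>\<omega>. \<Sum>i=1..n. Y n i \<omega>) = conv_power n \<mu>"
      using distr_sum_iid[OF _ assms(13)[OF that], of \<mu>] assms(14)[OF that] by (simp add: \<mu>_def)
    then have "measure (conv_power n \<mu>) {x n..} = measure (distr (M n) borel (\<lambda>\<omega>. \<Sum>i=1..n. Y n i \<omega>)) {x n..}"
      by simp
    also have "\<dots> = P n"
      unfolding P_def by (subst measure_distr[OF rv]) (auto intro!: arg_cong[where f = "measure (M n)"])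
    finally show ?thesis ..
  qed
  have "(\<lambda>n. real n / (x n)\<^sup>2 * ln (P n)) \<longlonglongrightarrow> - I"
  proof (rule tendstoI)
    fix r :: real assume r: "0 < r"
    have "I < I + r / 2" using r by simp
    \<comment> \<open>A near-minimiser, fixed independently of \<open>n\<close>, for the lower
      bound; the upper bound instead uses that \<open>I\<close> lies below \<open>G\<close> on all
      of [0,1]. The errors \<open>r / 2\<close> and \<open>r / 4\<close> stay below \<open>r\<close>
      in sum.\<close>
    then obtain t where t: "t \<in> {0..1}" "G t < I + r / 2"
      unfolding I_def using cINF_less_iff[OF _ bdd, of "(INF t\<in>{0..1}. G t) + r / 2"] by auto
    have "eventually (\<lambda>n. exp (- ((x n)\<^sup>2 / real n * (G t + r / 4))) \<le> measure (conv_power n \<mu>) {x n..}) sequentially"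
      unfolding G_def using t r by (intro iid_tail_lower \<mu>s e assms(15) x low) auto
    moreover have "eventually (\<lambda>n. P n \<le> exp (- ((x n)\<^sup>2 / real n * (I - r / 2)))) sequentially"
      unfolding P_def
      by (rule iid_tail_upper[OF \<mu>s e assms(15) x q up assms(12,13) _ I0 I_le[unfolded G_def]])
        (use r assms(14) in \<open>auto simp: \<mu>_def\<close>)
    ultimately show "eventually (\<lambda>n. dist (real n / (x n)\<^sup>2 * ln (P n)) (- I) < r) sequentially"
      using eventually_ge_at_top[of 1]
    proof eventually_elim
      case (elim n)
      define v where "v = (x n)\<^sup>2 / real n"
      have v: "0 < v" using sc(1)[OF elim(3)] elim(3) by (simp add: v_def)
      then have lv: "v * (ln (P n) / v) = ln (P n)" by simp
      have l: "exp (- (v * (G t + r / 4))) \<le> P n"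
        using elim(1) P_eq[OF elim(3)] by (simp add: v_def)
      \<comment> \<open>The lower bound also supplies positivity. In view of
        \<open>ln 0 = 0\<close>, the upper bound on \<open>P n\<close> can be passed to logarithms
        only after this.\<close>
      then have P0: "0 < P n" by (rule less_le_trans[OF exp_gt_zero])
      have "- (v * (G t + r / 4)) \<le> ln (P n)"
        using l P0 by (simp add: ln_ge_iff)
      then have "v * (- (G t + r / 4)) \<le> v * (ln (P n) / v)"
        unfolding lv mult_minus_right .
      then have a: "- (G t + r / 4) \<le> ln (P n) / v" using v by (simp only: mult_le_cancel_left_pos)
      have "ln (P n) \<le> ln (exp (- (v * (I - r / 2))))"
        using elim(2) P0 unfolding v_def by (subst ln_le_cancel_iff) auto
      then have "v * (ln (P n) / v) \<le> v * (- (I - r / 2))"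
        unfolding lv mult_minus_right ln_exp .
      then have b: "ln (P n) / v \<le> - (I - r / 2)" using v by (simp only: mult_le_cancel_left_pos)
      have "real n / (x n)\<^sup>2 * ln (P n) = ln (P n) / v" by (simp add: v_def)
      then show ?case
        using a b t(2) r unfolding dist_real_def by linarith
    qed
  qed
  then show ?thesis unfolding P_def I_def G_def .
qed

end
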